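(* Let $d\ge5$ and $0<\delta<1$. For every integer $k\ge2$ there exists a constant $c_k=c_k(d,\delta)>0$, and for every $0<\gamma<d-2$ there exists a constant $\mathfrak c=\mathfrak c(d,\delta,\gamma)>0$ (independent of $k$), such that the following holds. Put $p_N=N^{-\gamma}$ and let $\Omega_N\subseteq Q_N$ be the binomial random subset obtained by retaining each point of $Q_N$ independently with probability $p_N$. For every fixed integer $k\ge2$ and all sufficiently large $N$, with probability at least $1-\exp(-\mathfrak cN^{d-\gamma})$, every subset $B\subseteq\Omega_N$ with $|B|\ge\delta|\Omega_N|$ satisfies $$\Big|\big\{(a,b)\in\mathbb Z^2:\ a\ge0,\ b\ge1,\ \text{and } a+tb\in D^2(B)\text{ for every }0\le t\le k-1\big\}\Big|\ \ge\ c_kN^4 .$$ In particular, $D^2(B)$ contains at least $c_kN^4$ distinct nontrivial arithmetic progressions of length $k$.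
   Context: $Q_N=[-N,N]^d\cap\mathbb Z^d$. $D^2(B)=\{|\mathbf x-\mathbf y|^2:\mathbf x,\mathbf y\in B\}$ is the squared-distance set of $B$ (Euclidean norm). In the displayed set, $t$ ranges over integers. *)

theory Defs
  imports "HOL-Probability.Probability" "HOL-Probability.Product_PMF"
begin

text \<open>Points of $\mathbb Z^d$ are functions from \<open>{..<d}\<close> to the integers, extended by
  \<open>undefined\<close> outside \<open>{..<d}\<close>, so that \<open>d\<close> is an ordinary natural number.\<close>

definition int_cube :: "nat \<Rightarrow> nat \<Rightarrow> (nat \<Rightarrow> int) set" where
  "int_cube d N = {..<d} \<rightarrow>\<^sub>E {- int N..int N}"

text \<open>The squared Euclidean distance of integer points, kept in \<open>int\<close> since it is an integer.\<close>

definition sq_dist :: "nat \<Rightarrow> (nat \<Rightarrow> int) \<Rightarrow> (nat \<Rightarrow> int) \<Rightarrow> int" where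
  "sq_dist d x y = (\<Sum>i<d. (x i - y i)\<^sup>2)"

definition sq_dists :: "nat \<Rightarrow> (nat \<Rightarrow> int) set \<Rightarrow> int set" where
  "sq_dists d B = {sq_dist d x y | x y. x \<in> B \<and> y \<in> B}"

definition binomial_subset_pmf :: "'a set \<Rightarrow> real \<Rightarrow> 'a set pmf" where
  "binomial_subset_pmf A p =
     map_pmf (\<lambda>f. {x \<in> A. f x}) (Pi_pmf A False (\<lambda>_. bernoulli_pmf p))"

text \<open>Progressions are identified with their underlying sets, so \<open>a, a + b, \<dots>\<close> and its reversal
  are not counted separately.\<close>

definition nontrivial_AP :: "nat \<Rightarrow> int set \<Rightarrow> bool" where
  "nontrivial_AP k P \<longleftrightarrow> (\<exists>a b. b \<noteq> 0 \<and> P = {a + int t * b | t. t < k})"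

end

theory Submission
  imports Defs "HOL-Real_Asymp.Real_Asymp"
begin

text \<open>Write \<open>Q\<close> for the cube, \<open>n\<close> for its size and \<open>p\<close> for the retention probability. The theorem
  combines a statement about dense subsets of \<open>Q\<close> with a union bound over containers.

  Dense sets. For \<open>C \<subseteq> Q\<close> of positive density, the squared distance of a random pair from \<open>C\<close> has
  a distribution on \<open>{0..4dN\<^sup>2}\<close> which is almost invariant, in \<open>L\<^sup>1\<close>, under a positive proportion
  of the shifts \<open>h \<le> N\<^sup>2/k\<close>. Hence, if only a small proportion of the pairs have their distance
  outside a set \<open>S\<close>, then for each such \<open>h\<close> at least half of the pairs have a distance \<open>a\<close> with
  \<open>a, a + h, \<dots>, a + (k-1)h\<close> all in \<open>S\<close>. By an \<open>L\<^sup>2\<close> bound these distances \<open>a\<close> take at least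
  \<open>cN\<^sup>2\<close> values, so \<open>S\<close> contains at least \<open>cN\<^sup>4\<close> progressions
  (\<open>dense_sets_span_progressions\<close>).

  Almost invariance is a Fourier statement modulo \<open>M = 64dN\<^sup>2\<close>. A large sieve argument bounds the
  transform of the distance distribution by a power of a nonnegative majorant \<open>V\<close>: with
  \<open>e(t)\<close> for $e^{2\pi it}$,
  \<open>|\<Sum>\<^sub>x\<^sub>,\<^sub>y e(j|x-y|\<^sup>2/M)|\<^sup>2 \<le> |C|\<^sup>2 V(j)\<^sup>d\<close> (\<open>norm_distance_exp_sum_le\<close>). The fourth moment of \<open>V\<close>
  counts coincidences \<open>ab + ce = a'b' + c'e'\<close>, and the count has the expected order of magnitude
  with no logarithm (\<open>fourth_moment_majorant\<close>). As \<open>d > 4\<close>, the frequencies with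
  \<open>V(j) < \<eta>N\<^sup>2\<close> therefore carry little of the \<open>L\<^sup>2\<close> mass, and boundedly many frequencies remain;
  the pigeonhole principle gives the shifts \<open>h\<close> that are almost periods of all of those
  (\<open>many_common_almost_periods\<close>).

  Random sets. If the distance set \<open>S\<close> of \<open>B\<close> has few progressions, then \<open>B\<close> is independent in the
  graph that joins \<open>x\<close> and \<open>y\<close> when \<open>|x-y|\<^sup>2 \<notin> S\<close>. By the first part every dense subset of
  \<open>Q\<close> spans a positive proportion of all pairs in this graph. A bounded fingerprint \<open>T \<subseteq> B\<close>
  then determines a set of size less than \<open>\<delta>n/4\<close> which contains \<open>B\<close>
  (\<open>containers_for_few_progressions\<close>). Since there are at most \<open>exp(O(N\<^sup>2))\<close> choices of the
  pair \<open>(S, T)\<close> and \<open>N\<^sup>2\<close> is of smaller order than \<open>pn \<ge> N\<^sup>d\<^sup>-\<^sup>\<gamma>\<close>, a union bound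
  with exponential moments shows that with the required probability no container meets the random
  set in a proportion \<open>\<delta>\<close> of its points.\<close>

section \<open>Additive characters modulo M\<close>

text \<open>\<open>echar M z\<close> is $e^{2\pi i z/M}$. Everything is done modulo a large integer instead of on the
  circle, so that the Fourier analysis consists of finite sums.\<close>

definition echar :: "nat \<Rightarrow> int \<Rightarrow> complex" where
  "echar M z = cis (2 * pi * real_of_int z / real M)"

lemma norm_echar [simp]: "norm (echar M z) = 1"
  by (simp add: echar_def)

lemma echar_0 [simp]: "echar M 0 = 1"
  by (simp add: echar_def)

lemma echar_add: "echar M (a + b) = echar M a * echar M b"
  by (simp add: echar_def cis_mult ring_distribs add_divide_distrib)

lemma cnj_echar: "cnj (echar M a) = echar M (- a)"
  by (simp add: echar_def cis_cnj)

lemma echar_diff: "echar M (a - b) = echar M a * cnj (echar M b)"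
  using echar_add[of M a "- b"] by (simp add: cnj_echar)

lemma echar_sum: "finite I \<Longrightarrow> echar M (\<Sum>i\<in>I. f i) = (\<Prod>i\<in>I. echar M (f i))"
  by (induction I rule: finite_induct) (auto simp: echar_add)

lemma echar_power: "echar M (int j * z) = echar M z ^ j"
  by (induction j) (auto simp: echar_add ring_distribs)

lemma echar_eq_1_iff:
  assumes "M > 0"
  shows "echar M z = 1 \<longleftrightarrow> int M dvd z"
proof
  assume "echar M z = 1"
  then have "cos (2 * pi * real_of_int z / real M) = 1"
    by (simp add: echar_def complex_eq_iff)
  then obtain n :: int where "2 * pi * real_of_int z / real M = of_int n * 2 * pi"
    using cos_one_2pi_int by blast
  with assms have "real_of_int z = real_of_int (n * int M)"
    by (simp add: field_simps)
  then have "z = n * int M" by linarith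
  then show "int M dvd z" by simp
next
  assume "int M dvd z"
  then obtain n where z: "z = int M * n" by blast
  have "2 * pi * real_of_int z / real M = 2 * pi * real_of_int n"
    using assms by (simp add: z)
  then show "echar M z = 1" using assms by (simp add: echar_def cis_multiple_2pi)
qed

lemma echar_cong:
  assumes "M > 0" "a mod int M = b mod int M"
  shows "echar M a = echar M b"
proof -
  have "int M dvd a - b" using assms(2) by (simp add: mod_eq_dvd_iff)
  then have "echar M (a - b) = 1" using assms by (simp add: echar_eq_1_iff)
  then show ?thesis using echar_add[of M "a - b" b] by simp
qed

lemma echar_orthogonality:
  assumes "M > 0"
  shows "(\<Sum>j<M. echar M (int j * z)) = (if int M dvd z then of_nat M else 0)"
proof (cases "int M dvd z")
  case True
  then show ?thesis using assms by (simp add: echar_power echar_eq_1_iff[THEN iffD2])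
next
  case False
  then have "echar M z \<noteq> 1" using assms by (simp add: echar_eq_1_iff)
  moreover have "echar M z ^ M = 1"
    using assms by (simp add: echar_power[symmetric] echar_eq_1_iff)
  ultimately show ?thesis using False by (simp add: echar_power sum_gp_strict)
qed

lemma norm_sum_sq:
  fixes f :: "'a \<Rightarrow> complex"
  shows "of_real ((norm (sum f A))\<^sup>2) = (\<Sum>x\<in>A. \<Sum>y\<in>A. f x * cnj (f y))"
  by (simp only: complex_norm_square cnj_sum sum_product)

text \<open>Parseval for an exponential sum whose frequencies \<open>\<phi> p\<close> may repeat: expanding the square and
  summing over \<open>j\<close> leaves exactly the pairs with congruent frequencies.\<close>

lemma parseval_pairs:
  fixes a :: "'a \<Rightarrow> real"
  assumes M: "M > 0" and X: "finite X"
  shows "(\<Sum>j<M. (norm (\<Sum>p\<in>X. of_real (a p) * echar M (int j * \<phi> p)))\<^sup>2)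
       = M * (\<Sum>p\<in>X. \<Sum>q\<in>X. if int M dvd \<phi> p - \<phi> q then a p * a q else 0)"
proof -
  have "complex_of_real (\<Sum>j<M. (norm (\<Sum>p\<in>X. of_real (a p) * echar M (int j * \<phi> p)))\<^sup>2)
      = (\<Sum>j<M. \<Sum>p\<in>X. \<Sum>q\<in>X. of_real (a p * a q) * echar M (int j * (\<phi> p - \<phi> q)))"
    unfolding of_real_sum norm_sum_sq
    by (intro sum.cong refl) (simp add: right_diff_distrib echar_diff mult_ac)
  also have "\<dots> = (\<Sum>p\<in>X. \<Sum>q\<in>X. \<Sum>j<M. of_real (a p * a q) * echar M (int j * (\<phi> p - \<phi> q)))"
    by (subst sum.swap, intro sum.cong refl, subst sum.swap, rule refl)
  also have "\<dots> = (\<Sum>p\<in>X. \<Sum>q\<in>X. of_real (if int M dvd \<phi> p - \<phi> q then M * (a p * a q) else 0))"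
    by (intro sum.cong refl) (simp add: sum_distrib_left[symmetric] echar_orthogonality[OF M])
  also have "\<dots> = of_real (M * (\<Sum>p\<in>X. \<Sum>q\<in>X. if int M dvd \<phi> p - \<phi> q then a p * a q else 0))"
    by (simp only: of_real_sum[symmetric] sum_distrib_left if_distrib[of "(*) _"] mult_zero_right)
  finally show ?thesis by (simp only: of_real_eq_iff)
qed

lemma sum_by_residue:
  fixes g :: "int \<Rightarrow> 'b::comm_semiring_1"
  assumes M: "M > 0" and X: "finite X"
  shows "(\<Sum>p\<in>X. a p * g (\<phi> p mod int M)) =
         (\<Sum>z\<in>{0..<int M}. (\<Sum>p\<in>{p\<in>X. \<phi> p mod int M = z}. a p) * g z)"
proof -
  have "(\<Sum>z\<in>{0..<int M}. (\<Sum>p\<in>{p\<in>X. \<phi> p mod int M = z}. a p) * g z)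
      = (\<Sum>z\<in>{0..<int M}. \<Sum>p\<in>{p\<in>X. \<phi> p mod int M = z}. a p * g (\<phi> p mod int M))"
    by (intro sum.cong refl) (auto simp: sum_distrib_right)
  also have "\<dots> = (\<Sum>p\<in>X. a p * g (\<phi> p mod int M))"
    using M X by (intro sum.group) auto
  finally show ?thesis ..
qed

lemma parseval_residues:
  fixes f :: "int \<Rightarrow> real"
  assumes M: "M > 0"
  shows "(\<Sum>j<M. (norm (\<Sum>z\<in>{0..<int M}. of_real (f z) * echar M (int j * z)))\<^sup>2)
       = M * (\<Sum>z\<in>{0..<int M}. (f z)\<^sup>2)"
proof -
  have eq: "int M dvd p - q \<longleftrightarrow> q = p" if "p \<in> {0..<int M}" "q \<in> {0..<int M}" for p q
    using that by (auto simp: mod_eq_dvd_iff[symmetric])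
  have "(\<Sum>q\<in>{0..<int M}. if int M dvd z - q then f z * f q else 0) = (f z)\<^sup>2"
    if z: "z \<in> {0..<int M}" for z
  proof -
    have "(\<Sum>q\<in>{0..<int M}. if int M dvd z - q then f z * f q else 0)
        = (\<Sum>q\<in>{0..<int M}. if q = z then f z * f q else 0)"
      by (intro sum.cong refl) (use eq[OF z] in simp)
    then show ?thesis using z by (simp add: power2_eq_square)
  qed
  then show ?thesis
    by (simp add: parseval_pairs[OF M finite_atLeastLessThan_int])
qed

section \<open>Coincidences of the form a b + c e\<close>

lemma card_le_of_dvd_differences:
  fixes A :: "int set" and s :: int
  assumes "A \<subseteq> {lo..hi}" "s > 0" "lo \<le> hi"
    and dvd: "\<And>x y. x \<in> A \<Longrightarrow> y \<in> A \<Longrightarrow> s dvd x - y"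
  shows "real (card A) \<le> real_of_int (hi - lo) / real_of_int s + 1"
proof (cases "A = {}")
  case True
  then show ?thesis using assms by simp
next
  case False
  have fin: "finite A" using assms(1) finite_subset by blast
  define m where "m = Min A"
  have m: "m \<in> A" "\<And>x. x \<in> A \<Longrightarrow> m \<le> x" using fin False by (auto simp: m_def)
  have inj: "inj_on (\<lambda>x. (x - m) div s) A"
  proof (rule inj_onI)
    fix x y assume "x \<in> A" "y \<in> A" and eq: "(x - m) div s = (y - m) div s"
    then have "s dvd x - m" "s dvd y - m" using dvd m by auto
    then show "x = y" using eq by (metis diff_add_cancel dvd_div_mult_self)
  qed
  have "(\<lambda>x. (x - m) div s) ` A \<subseteq> {0..(hi - lo) div s}"
  proof safe
    fix x assume x: "x \<in> A"
    have "x \<in> {lo..hi}" "m \<in> {lo..hi}" using m x assms(1) by blast+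
    then have "0 \<le> x - m" "x - m \<le> hi - lo" using m(2)[OF x] by auto
    then show "(x - m) div s \<in> {0..(hi - lo) div s}"
      using \<open>s > 0\<close> by (auto intro: zdiv_mono1 simp: pos_imp_zdiv_nonneg_iff)
  qed
  then have "card A \<le> card {0..(hi - lo) div s}"
    using card_inj_on_le[OF inj] by blast
  also have "\<dots> = nat ((hi - lo) div s + 1)" by simp
  also have "0 \<le> (hi - lo) div s"
    using assms by (simp add: pos_imp_zdiv_nonneg_iff)
  then have "nat ((hi - lo) div s + 1) = nat ((hi - lo) div s) + 1" by linarith
  finally have "int (card A) \<le> (hi - lo) div s + 1"
    using \<open>0 \<le> (hi - lo) div s\<close> by linarith
  moreover have "real_of_int ((hi - lo) div s) \<le> real_of_int (hi - lo) / real_of_int s"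
  proof -
    have "(hi - lo) div s * s \<le> hi - lo" using \<open>s > 0\<close> by (simp add: minus_mod_eq_div_mult[symmetric])
    then have "real_of_int ((hi - lo) div s * s) \<le> real_of_int (hi - lo)" by (simp only: of_int_le_iff)
    then show ?thesis using \<open>s > 0\<close> by (simp add: le_divide_eq)
  qed
  ultimately show ?thesis by linarith
qed

definition bilinear_reps :: "nat \<Rightarrow> int \<Rightarrow> (int \<times> int \<times> int \<times> int) set" where
  "bilinear_reps K n = {(a, b, c, e). a \<in> {-int K..int K} \<and> b \<in> {-int K..int K} \<and>
     c \<in> {-int K..int K} \<and> e \<in> {-int K..int K} \<and> a * b + c * e = n}"

lemma finite_bilinear_reps [simp]: "finite (bilinear_reps K n)"
  by (rule finite_subset[of _ "{-int K..int K} \<times> {-int K..int K} \<times> {-int K..int K} \<times> {-int K..int K}"])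
    (auto simp: bilinear_reps_def)

text \<open>On the line \<open>a b + c e = n\<close> the coordinate \<open>e\<close> determines \<open>b\<close>, and two values of \<open>e\<close> differ
  by a multiple of \<open>a / gcd a c\<close>.\<close>

lemma card_line_points:
  assumes a: "a \<noteq> 0" "\<bar>a\<bar> \<le> int K"
  shows "real (card {(b, e). b \<in> {-int K..int K} \<and> e \<in> {-int K..int K} \<and> a * b + c * e = n})
    \<le> (if gcd a c dvd n then 3 * real K * gcd a c / \<bar>a\<bar> else 0)"
proof -
  define L where "L = {(b, e). b \<in> {-int K..int K} \<and> e \<in> {-int K..int K} \<and> a * b + c * e = n}"
  show ?thesis
  proof (cases "gcd a c dvd n")
    case False
    then have "L = {}" by (auto simp: L_def)
    then have "real (card L) \<le> (if gcd a c dvd n then 3 * real K * gcd a c / \<bar>a\<bar> else 0)"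
      using False by simp
    then show ?thesis unfolding L_def .
  next
    case True
    define g where "g = gcd a c"
    have g: "g > 0" using a by (simp add: g_def)
    obtain a' c' where "a = a' * g" and "c = c' * g" and cop: "coprime a' c'"
      using gcd_coprime_exists[of a c, folded g_def] g by auto
    then have a': "a = g * a'" and c': "c = g * c'" by (auto simp: mult.commute)
    have a'0: "a' \<noteq> 0" using a a' by auto
    have inj: "inj_on snd L"
      using a by (auto simp: L_def inj_on_def)
    have "real (card (snd ` L)) \<le> real_of_int (int K - (- int K)) / real_of_int \<bar>a'\<bar> + 1"
    proof (rule card_le_of_dvd_differences)
      fix x y assume x: "x \<in> snd ` L" and y: "y \<in> snd ` L"
      obtain p q where p: "p \<in> L" "x = snd p" and q: "q \<in> L" "y = snd q" using x y by blast
      define b b' where "b = fst p" and "b' = fst q"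
      have "a * b + c * x = n" "a * b' + c * y = n"
        using p q by (simp_all add: L_def case_prod_unfold b_def b'_def)
      then have "g * (c' * (x - y)) = g * (a' * (b' - b))" by (simp add: a' c' algebra_simps)
      then have "c' * (x - y) = a' * (b' - b)" using g by simp
      then have "a' dvd c' * (x - y)" by simp
      then show "\<bar>a'\<bar> dvd x - y" using cop by (simp add: coprime_dvd_mult_right_iff)
    next
      show "snd ` L \<subseteq> {-int K..int K}" by (auto simp: L_def)
    next
      show "0 < \<bar>a'\<bar>" using a'0 by simp
    next
      show "- int K \<le> int K" by simp
    qed
    also have "card (snd ` L) = card L" using inj by (rule card_image)
    also have "real_of_int (int K - (- int K)) / real_of_int \<bar>a'\<bar> + 1 \<le> 3 * real K * g / \<bar>a\<bar>"
    proof -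
      define A where "A = real_of_int \<bar>a'\<bar>"
      have A: "A > 0" using a'0 by (simp add: A_def)
      have "1 * \<bar>a'\<bar> \<le> g * \<bar>a'\<bar>" using g by (intro mult_right_mono) auto
      then have "\<bar>a'\<bar> \<le> int K" using a(2) g by (simp add: a' abs_mult)
      then have "A \<le> real K" unfolding A_def by linarith
      then have f1: "1 \<le> real K / A" using A by (simp add: le_divide_eq)
      have f2: "3 * real K * g / \<bar>a\<bar> = 3 * (real K / A)"
        using g by (simp add: a' abs_mult A_def)
      have f3: "real_of_int (int K - (- int K)) / real_of_int \<bar>a'\<bar> = 2 * (real K / A)"
        by (simp add: A_def)
      show ?thesis unfolding f2 f3 using f1 by linarith
    qed
    finally have "real (card L) \<le> (if gcd a c dvd n then 3 * real K * gcd a c / \<bar>a\<bar> else 0)"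
      using True by (simp add: g_def)
    then show ?thesis unfolding L_def .
  qed
qed

lemma card_multiples_le:
  assumes "g > 0" "int g \<le> R"
  shows "real (card {x \<in> {-R..R}. int g dvd x}) \<le> 3 * real_of_int R / real g"
proof -
  have "real (card {x \<in> {-R..R}. int g dvd x}) \<le> real_of_int (R - (-R)) / real_of_int (int g) + 1"
    by (rule card_le_of_dvd_differences) (use assms in auto)
  also have "\<dots> \<le> 3 * real_of_int R / real g"
    using assms by (simp add: field_simps)
  finally show ?thesis .
qed

lemma card_filter_sum:
  "finite D \<Longrightarrow> real (card {x\<in>D. P x}) = (\<Sum>x\<in>D. if P x then 1 else 0)"
  by (simp add: sum.If_cases Int_def)

definition recip_divisor_sum :: "nat \<Rightarrow> int \<Rightarrow> real" where
  "recip_divisor_sum K n = (\<Sum>g\<in>{g\<in>{1..K}. int g dvd n}. 1 / real g)"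

text \<open>The gcd is bounded by the sum of all its divisors \<open>g\<close>, and a proportion \<open>1/g\<close> of the \<open>c\<close> is
  divisible by \<open>g\<close>, so that every divisor contributes \<open>O(\<bar>a\<bar>)\<close>.\<close>

lemma sum_gcd_le:
  assumes a: "a \<noteq> 0" "\<bar>a\<bar> \<le> int K"
  shows "(\<Sum>c\<in>{-\<bar>a\<bar>..\<bar>a\<bar>}. if gcd a c dvd n then real_of_int (gcd a c) else 0)
    \<le> 3 * real_of_int \<bar>a\<bar> * real (card {g\<in>{1..K}. int g dvd n \<and> int g dvd a})"
proof -
  define D where "D = {g\<in>{1..K}. int g dvd n \<and> int g dvd a}"
  have "(\<Sum>c\<in>{-\<bar>a\<bar>..\<bar>a\<bar>}. if gcd a c dvd n then real_of_int (gcd a c) else 0)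
     \<le> (\<Sum>c\<in>{-\<bar>a\<bar>..\<bar>a\<bar>}. \<Sum>g\<in>D. if int g dvd c then real g else 0)"
  proof (rule sum_mono)
    fix c assume "c \<in> {-\<bar>a\<bar>..\<bar>a\<bar>}"
    show "(if gcd a c dvd n then real_of_int (gcd a c) else 0) \<le> (\<Sum>g\<in>D. if int g dvd c then real g else 0)"
    proof (cases "gcd a c dvd n")
      case True
      define g where "g = nat (gcd a c)"
      have g: "int g = gcd a c" by (simp add: g_def)
      have "gcd a c > 0" using a by simp
      moreover have "gcd a c \<le> \<bar>a\<bar>" using a by (intro zdvd_imp_le) auto
      ultimately have "1 \<le> g" "g \<le> K" using a g by linarith+
      then have "g \<in> D" using True by (auto simp: D_def g)
      then have "(if int g dvd c then real g else 0) \<le> (\<Sum>g\<in>D. if int g dvd c then real g else 0)"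
        by (intro member_le_sum) (auto simp: D_def)
      moreover have "int g dvd c" by (simp add: g)
      moreover have "real_of_int (gcd a c) = real g" by (simp flip: g)
      ultimately show ?thesis using True by simp
    next
      case False then show ?thesis by (simp add: sum_nonneg)
    qed
  qed
  also have "\<dots> = (\<Sum>g\<in>D. real g * real (card {c\<in>{-\<bar>a\<bar>..\<bar>a\<bar>}. int g dvd c}))"
    by (subst sum.swap) (simp add: sum.If_cases Int_def mult.commute)
  also have "\<dots> \<le> (\<Sum>g\<in>D. 3 * real_of_int \<bar>a\<bar>)"
  proof (rule sum_mono)
    fix g assume g: "g \<in> D"
    then have "int g \<le> \<bar>a\<bar>" using a by (intro zdvd_imp_le) (auto simp: D_def)
    moreover have "g > 0" using g by (auto simp: D_def)
    ultimately show "real g * real (card {c\<in>{-\<bar>a\<bar>..\<bar>a\<bar>}. int g dvd c}) \<le> 3 * real_of_int \<bar>a\<bar>"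
      using card_multiples_le[of g "\<bar>a\<bar>"] by (simp add: field_simps)
  qed
  finally show ?thesis by (simp add: D_def mult.commute)
qed

text \<open>By symmetry \<open>\<bar>c\<bar> \<le> \<bar>a\<bar>\<close> may be assumed, and then \<open>a \<noteq> 0\<close> because \<open>n \<noteq> 0\<close>. Counting the points
  on each line \<open>a b + c e = n\<close> and summing over \<open>c\<close>, then over \<open>a\<close>, gives the main term \<open>K\<^sup>2\<close>
  times the usual singular factor.\<close>

lemma card_bilinear_reps_le:
  assumes n: "n \<noteq> 0"
  shows "real (card (bilinear_reps K n)) \<le> 54 * real K ^ 2 * recip_divisor_sum K n"
proof -
  define B where "B = {-int K..int K}"
  define L where "L = (\<lambda>a c. {(b, e). b \<in> B \<and> e \<in> B \<and> a * b + c * e = n})"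
  define R where "R = {(a, b, c, e) \<in> bilinear_reps K n. \<bar>c\<bar> \<le> \<bar>a\<bar>}"
  have finL: "finite (L a c)" for a c
    by (rule finite_subset[of _ "B \<times> B"]) (auto simp: L_def B_def)
  have finR: "finite R" unfolding R_def by (rule finite_subset[OF _ finite_bilinear_reps[of K n]]) auto
  have "bilinear_reps K n \<subseteq> R \<union> (\<lambda>(a, b, c, e). (c, e, a, b)) ` R"
  proof
    fix x assume x: "x \<in> bilinear_reps K n"
    obtain a b c e where xe: "x = (a, b, c, e)" by (cases x) auto
    show "x \<in> R \<union> (\<lambda>(a, b, c, e). (c, e, a, b)) ` R"
    proof (cases "\<bar>c\<bar> \<le> \<bar>a\<bar>")
      case True
      then show ?thesis using x by (simp add: R_def xe)
    next
      case False
      then have "(c, e, a, b) \<in> R" using x by (simp add: R_def bilinear_reps_def xe add.commute)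
      then have "(\<lambda>(a, b, c, e). (c, e, a, b)) (c, e, a, b) \<in> (\<lambda>(a, b, c, e). (c, e, a, b)) ` R"
        by (rule imageI)
      then show ?thesis by (simp add: xe)
    qed
  qed
  then have "card (bilinear_reps K n) \<le> card (R \<union> (\<lambda>(a, b, c, e). (c, e, a, b)) ` R)"
    using finR by (intro card_mono) auto
  also have "\<dots> \<le> card R + card R"
    by (rule order_trans[OF card_Un_le]) (use card_image_le[OF finR] in auto)
  finally have 1: "real (card (bilinear_reps K n)) \<le> 2 * real (card R)" by simp
  have "R \<subseteq> (\<lambda>((a, c), (b, e)). (a, b, c, e)) ` (SIGMA ac : (SIGMA a : B - {0}. {-\<bar>a\<bar>..\<bar>a\<bar>}). L (fst ac) (snd ac))"
  proof
    fix x assume x: "x \<in> R"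
    obtain a b c e where xe: "x = (a, b, c, e)" by (cases x) auto
    have "a \<noteq> 0" using x n by (auto simp: R_def bilinear_reps_def xe)
    then have "((a, c), (b, e)) \<in> (SIGMA ac : (SIGMA a : B - {0}. {-\<bar>a\<bar>..\<bar>a\<bar>}). L (fst ac) (snd ac))"
      using x by (auto simp: R_def bilinear_reps_def xe L_def B_def)
    then show "x \<in> (\<lambda>((a, c), (b, e)). (a, b, c, e)) ` (SIGMA ac : (SIGMA a : B - {0}. {-\<bar>a\<bar>..\<bar>a\<bar>}). L (fst ac) (snd ac))"
      by (rule rev_image_eqI) (simp add: xe)
  qed
  then have "card R \<le> card (SIGMA ac : (SIGMA a : B - {0}. {-\<bar>a\<bar>..\<bar>a\<bar>}). L (fst ac) (snd ac))"
    by (rule surj_card_le[rotated]) (use finL in \<open>auto simp: B_def\<close>)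
  also have "\<dots> = (\<Sum>ac\<in>(SIGMA a : B - {0}. {-\<bar>a\<bar>..\<bar>a\<bar>}). card (L (fst ac) (snd ac)))"
    by (rule card_SigmaI) (use finL in \<open>auto simp: B_def\<close>)
  also have "\<dots> = (\<Sum>a\<in>B - {0}. \<Sum>c\<in>{-\<bar>a\<bar>..\<bar>a\<bar>}. card (L a c))"
    by (subst sum.Sigma) (auto simp: B_def case_prod_unfold)
  finally have "real (card R) \<le> real (\<Sum>a\<in>B - {0}. \<Sum>c\<in>{-\<bar>a\<bar>..\<bar>a\<bar>}. card (L a c))"
    by (simp only: of_nat_le_iff)
  also have "\<dots> \<le> (\<Sum>a\<in>B - {0}. 9 * real K * real (card {g\<in>{1..K}. int g dvd n \<and> int g dvd a}))"
    unfolding of_nat_sum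
  proof (rule sum_mono)
    fix a assume "a \<in> B - {0}"
    then have a: "a \<noteq> 0" "\<bar>a\<bar> \<le> int K" by (auto simp: B_def)
    have "(\<Sum>c\<in>{-\<bar>a\<bar>..\<bar>a\<bar>}. real (card (L a c)))
       \<le> (\<Sum>c\<in>{-\<bar>a\<bar>..\<bar>a\<bar>}. (3 * real K / \<bar>a\<bar>) * (if gcd a c dvd n then real_of_int (gcd a c) else 0))"
    proof (rule sum_mono)
      fix c
      have "real (card (L a c)) \<le> (if gcd a c dvd n then 3 * real K * gcd a c / \<bar>a\<bar> else 0)"
        unfolding L_def B_def by (rule card_line_points[OF a])
      then show "real (card (L a c)) \<le> (3 * real K / \<bar>a\<bar>) * (if gcd a c dvd n then real_of_int (gcd a c) else 0)"
        by (cases "gcd a c dvd n") simp_all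
    qed
    also have "\<dots> = (3 * real K / \<bar>a\<bar>) * (\<Sum>c\<in>{-\<bar>a\<bar>..\<bar>a\<bar>}. if gcd a c dvd n then real_of_int (gcd a c) else 0)"
      by (rule sum_distrib_left[symmetric])
    also have "\<dots> \<le> (3 * real K / \<bar>a\<bar>) * (3 * real_of_int \<bar>a\<bar> * real (card {g\<in>{1..K}. int g dvd n \<and> int g dvd a}))"
      by (rule mult_left_mono[OF sum_gcd_le[OF a]]) simp
    also have "\<dots> = 9 * real K * real (card {g\<in>{1..K}. int g dvd n \<and> int g dvd a})"
      using a by simp
    finally show "(\<Sum>c\<in>{-\<bar>a\<bar>..\<bar>a\<bar>}. real (card (L a c))) \<le> \<dots>" .
  qed
  also have "\<dots> = 9 * real K * (\<Sum>a\<in>B - {0}. \<Sum>g\<in>{g\<in>{1..K}. int g dvd n}. if int g dvd a then 1 else 0)"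
  proof -
    have "real (card {g\<in>{1..K}. int g dvd n \<and> int g dvd a})
        = (\<Sum>g\<in>{g\<in>{1..K}. int g dvd n}. if int g dvd a then 1 else 0)" for a
      by (subst card_filter_sum[symmetric]) (auto intro: arg_cong[where f=card])
    then show ?thesis by (simp only: sum_distrib_left)
  qed
  also have "\<dots> = 9 * real K * (\<Sum>g\<in>{g\<in>{1..K}. int g dvd n}. real (card {a\<in>B - {0}. int g dvd a}))"
  proof -
    have "(\<Sum>a\<in>B - {0}. if int g dvd a then 1 else 0) = real (card {a\<in>B - {0}. int g dvd a})" for g
      by (rule card_filter_sum[symmetric]) (simp add: B_def)
    then show ?thesis by (subst sum.swap) simp
  qed
  also have "\<dots> \<le> 9 * real K * (\<Sum>g\<in>{g\<in>{1..K}. int g dvd n}. 3 * real K * (1 / real g))"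
  proof (intro mult_left_mono sum_mono)
    fix g assume g: "g \<in> {g\<in>{1..K}. int g dvd n}"
    have "card {a\<in>B - {0}. int g dvd a} \<le> card {a\<in>B. int g dvd a}"
      by (intro card_mono finite_subset[of "{a\<in>B. int g dvd a}" B]) (auto simp: B_def)
    then show "real (card {a\<in>B - {0}. int g dvd a}) \<le> 3 * real K * (1 / real g)"
      using card_multiples_le[of g "int K"] g by (simp add: B_def)
  qed simp
  also have "\<dots> = 27 * real K ^ 2 * recip_divisor_sum K n"
    by (simp add: recip_divisor_sum_def sum_distrib_left power2_eq_square)
  finally show ?thesis using 1 by simp
qed

text \<open>For \<open>n = 0\<close> the bound \<open>O(K\<^sup>3)\<close> suffices: its square has the order \<open>K\<^sup>6\<close> of the whole second
  moment.\<close>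

lemma card_bilinear_reps_0:
  assumes "K \<ge> 1"
  shows "real (card (bilinear_reps K 0)) \<le> 81 * real K ^ 3"
proof -
  define B where "B = {-int K..int K}"
  define R where "R = bilinear_reps K 0"
  have B3: "card (B \<times> B \<times> B) = (2 * K + 1) ^ 3"
  proof -
    have "card B = 2 * K + 1" by (simp add: B_def nat_add_distrib nat_mult_distrib)
    then show ?thesis by (simp only: card_cartesian_product power3_eq_cube mult.assoc)
  qed
  have "card {(a, b, c, e) \<in> R. c \<noteq> 0} \<le> card (B \<times> B \<times> B)"
  proof (rule card_inj_on_le[of "\<lambda>(a, b, c, e). (a, b, c)"])
    show "inj_on (\<lambda>(a, b, c, e). (a, b, c)) {(a, b, c, e) \<in> R. c \<noteq> 0}"
    proof (rule inj_onI)
      fix x y assume x: "x \<in> {(a, b, c, e) \<in> R. c \<noteq> 0}" and y: "y \<in> {(a, b, c, e) \<in> R. c \<noteq> 0}"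
        and eq: "(\<lambda>(a, b, c, e). (a, b, c)) x = (\<lambda>(a, b, c, e). (a, b, c)) y"
      obtain a b c e e' where xy: "x = (a, b, c, e)" "y = (a, b, c, e')"
        using eq by (cases x; cases y) auto
      have "c \<noteq> 0" "a * b + c * e = a * b + c * e'"
        using x y unfolding xy R_def bilinear_reps_def by simp_all
      then show "x = y" by (simp add: xy)
    qed
    show "(\<lambda>(a, b, c, e). (a, b, c)) ` {(a, b, c, e) \<in> R. c \<noteq> 0} \<subseteq> B \<times> B \<times> B"
      by (fastforce simp: R_def bilinear_reps_def B_def)
  qed (simp add: B_def)
  moreover have "card {(a, b, c, e) \<in> R. c = 0 \<and> a \<noteq> 0} \<le> card (B \<times> B \<times> B)"
    by (rule card_inj_on_le[of "\<lambda>(a, b, c, e). (a, c, e)"])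
       (auto simp: inj_on_def R_def bilinear_reps_def B_def)
  moreover have "card {(a, b, c, e) \<in> R. c = 0 \<and> a = 0} \<le> card (B \<times> B \<times> B)"
    by (rule card_inj_on_le[of "\<lambda>(a, b, c, e). (b, c, e)"])
       (auto simp: inj_on_def R_def bilinear_reps_def B_def)
  moreover have "R = {(a, b, c, e) \<in> R. c \<noteq> 0} \<union> {(a, b, c, e) \<in> R. c = 0 \<and> a \<noteq> 0} \<union> {(a, b, c, e) \<in> R. c = 0 \<and> a = 0}"
    by auto
  then have "card R \<le> card {(a, b, c, e) \<in> R. c \<noteq> 0} + card {(a, b, c, e) \<in> R. c = 0 \<and> a \<noteq> 0} + card {(a, b, c, e) \<in> R. c = 0 \<and> a = 0}"
    by (metis (no_types, lifting) card_Un_le add_le_mono1 order_trans)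
  ultimately have "card R \<le> 3 * (2 * K + 1) ^ 3" using B3 by linarith
  also have "\<dots> \<le> 3 * (3 * K) ^ 3" using assms by (intro mult_left_mono power_mono) auto
  finally have "real (card R) \<le> real (3 * (3 * K) ^ 3)" by (simp only: of_nat_le_iff)
  then show ?thesis by (simp add: R_def power_mult_distrib)
qed

text \<open>Cauchy-Schwarz with \<open>1/g = g\<^sup>-\<^sup>3\<^sup>/\<^sup>4 \<cdot> g\<^sup>-\<^sup>1\<^sup>/\<^sup>4\<close>. The exponents are chosen so that averaging the last
  factor over \<open>n\<close> again produces the convergent series \<open>\<Sum> g\<^sup>-\<^sup>3\<^sup>/\<^sup>2\<close>.\<close>

lemma recip_divisor_sum_sq_le:
  "(recip_divisor_sum K n)\<^sup>2 \<le> (\<Sum>g\<in>{1..K}. real g powr (-3/2)) *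
     (\<Sum>g\<in>{g\<in>{1..K}. int g dvd n}. real g powr (-1/2))"
proof -
  define D where "D = {g\<in>{1..K}. int g dvd n}"
  have "recip_divisor_sum K n = (\<Sum>g\<in>D. real g powr (-3/4) * real g powr (-1/4))"
    unfolding recip_divisor_sum_def D_def
  proof (intro sum.cong refl)
    fix g assume "g \<in> {g\<in>{1..K}. int g dvd n}"
    then have "real g powr (-1) = 1 / real g" by (simp add: powr_neg_one)
    moreover have "real g powr (-3/4) * real g powr (-1/4) = real g powr (-3/4 + -1/4)"
      by (simp only: powr_add)
    ultimately show "1 / real g = real g powr (-3/4) * real g powr (-1/4)" by simp
  qed
  then have "(recip_divisor_sum K n)\<^sup>2 \<le> (\<Sum>g\<in>D. (real g powr (-3/4))\<^sup>2) * (\<Sum>g\<in>D. (real g powr (-1/4))\<^sup>2)"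
    by (simp only: Cauchy_Schwarz_ineq_sum)
  also have "\<dots> = (\<Sum>g\<in>D. real g powr (-3/2)) * (\<Sum>g\<in>D. real g powr (-1/2))"
    by (simp add: power2_eq_square powr_add[symmetric])
  also have "\<dots> \<le> (\<Sum>g\<in>{1..K}. real g powr (-3/2)) * (\<Sum>g\<in>D. real g powr (-1/2))"
    by (intro mult_right_mono sum_mono2 sum_nonneg) (auto simp: D_def)
  finally show ?thesis by (simp add: D_def)
qed

lemma sum_card_bilinear_reps_sq_le:
  "\<exists>C>0. \<forall>K\<ge>1. (\<Sum>n\<in>{-2 * int K ^ 2..2 * int K ^ 2}. (real (card (bilinear_reps K n)))\<^sup>2) \<le> C * real K ^ 6"
proof -
  define Z where "Z = (\<Sum>g. real g powr (-3/2))"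
  have summ: "summable (\<lambda>g. real g powr (-3/2))" by (simp add: summable_real_powr_iff)
  have Z: "(\<Sum>g\<in>{1..K}. real g powr (-3/2)) \<le> Z" for K :: nat
    unfolding Z_def by (rule sum_le_suminf[OF summ]) auto
  have Z0: "Z \<ge> 0" using Z[of 0] by simp
  have "(\<Sum>n\<in>{-2 * int K ^ 2..2 * int K ^ 2}. (real (card (bilinear_reps K n)))\<^sup>2) \<le> (81\<^sup>2 + 54\<^sup>2 * 6 * Z\<^sup>2) * real K ^ 6"
    if K: "K \<ge> 1" for K
  proof -
    define I where "I = {-2 * int K ^ 2..2 * int K ^ 2}"
    have mult: "real (card {n\<in>I - {0}. int g dvd n}) \<le> 6 * real K ^ 2 / real g" if g: "g \<in> {1..K}" for g
    proof -
      have "g * 1 \<le> K * K" using g by (intro mult_mono) auto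
      then have "int g \<le> int (K * K)" using of_nat_le_iff[of g "K * K"] by simp
      then have "int g \<le> 2 * int K ^ 2" by (simp add: power2_eq_square)
      moreover have "card {n\<in>I - {0}. int g dvd n} \<le> card {n\<in>I. int g dvd n}"
        by (intro card_mono finite_subset[of "{n\<in>I. int g dvd n}" I]) (auto simp: I_def)
      ultimately show ?thesis using card_multiples_le[of g "2 * int K ^ 2"] g by (simp add: I_def)
    qed
    have "(\<Sum>n\<in>I - {0}. (real (card (bilinear_reps K n)))\<^sup>2)
       \<le> (\<Sum>n\<in>I - {0}. (54 * real K ^ 2)\<^sup>2 * (Z * (\<Sum>g\<in>{g\<in>{1..K}. int g dvd n}. real g powr (-1/2))))"
    proof (rule sum_mono)
      fix n assume "n \<in> I - {0}"
      then have "(real (card (bilinear_reps K n)))\<^sup>2 \<le> (54 * real K ^ 2 * recip_divisor_sum K n)\<^sup>2"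
        by (intro power_mono card_bilinear_reps_le) auto
      also have "\<dots> = (54 * real K ^ 2)\<^sup>2 * (recip_divisor_sum K n)\<^sup>2" by (rule power_mult_distrib)
      also have "\<dots> \<le> (54 * real K ^ 2)\<^sup>2 * (Z * (\<Sum>g\<in>{g\<in>{1..K}. int g dvd n}. real g powr (-1/2)))"
        by (intro mult_left_mono order_trans[OF recip_divisor_sum_sq_le] mult_right_mono Z sum_nonneg) auto
      finally show "(real (card (bilinear_reps K n)))\<^sup>2 \<le> \<dots>" .
    qed
    also have "\<dots> = (54 * real K ^ 2)\<^sup>2 * Z * (\<Sum>n\<in>I - {0}. \<Sum>g\<in>{g\<in>{1..K}. int g dvd n}. real g powr (-1/2))"
      by (simp add: sum_distrib_left mult_ac)
    also have "(\<Sum>n\<in>I - {0}. \<Sum>g\<in>{g\<in>{1..K}. int g dvd n}. real g powr (-1/2))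
       = (\<Sum>g\<in>{1..K}. \<Sum>n\<in>{n\<in>I - {0}. int g dvd n}. real g powr (-1/2))"
      by (rule sum.swap_restrict) (auto simp: I_def)
    also have "\<dots> = (\<Sum>g\<in>{1..K}. real (card {n\<in>I - {0}. int g dvd n}) * real g powr (-1/2))"
      by simp
    also have "\<dots> \<le> (\<Sum>g\<in>{1..K}. (6 * real K ^ 2 / real g) * real g powr (-1/2))"
      by (intro sum_mono mult_right_mono mult) auto
    also have "\<dots> = (\<Sum>g\<in>{1..K}. (6 * real K ^ 2) * real g powr (-3/2))"
    proof (intro sum.cong refl)
      fix g assume "g \<in> {1..K}"
      then have "real g > 0" by simp
      have "real g powr (-3/2) = real g powr (-1 + -1/2)" by simp
      also have "\<dots> = real g powr (-1) * real g powr (-1/2)" by (simp only: powr_add)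
      also have "\<dots> = 1 / real g * real g powr (-1/2)"
        using \<open>real g > 0\<close> by (simp only: powr_neg_one)
      finally show "(6 * real K ^ 2 / real g) * real g powr (-1/2) = (6 * real K ^ 2) * real g powr (-3/2)"
        by (simp only: times_divide_eq_left times_divide_eq_right mult_1_left)
    qed
    also have "\<dots> = (6 * real K ^ 2) * (\<Sum>g\<in>{1..K}. real g powr (-3/2))" by (simp add: sum_distrib_left)
    also have "\<dots> \<le> (6 * real K ^ 2) * Z" by (intro mult_left_mono Z) auto
    finally have "(\<Sum>n\<in>I - {0}. (real (card (bilinear_reps K n)))\<^sup>2) \<le> (54 * real K ^ 2)\<^sup>2 * Z * ((6 * real K ^ 2) * Z)"
      using Z0 by (simp add: mult_left_mono)
    also have "\<dots> = 54\<^sup>2 * 6 * Z\<^sup>2 * real K ^ 6" by (simp add: eval_nat_numeral mult_ac)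
    finally have 1: "(\<Sum>n\<in>I - {0}. (real (card (bilinear_reps K n)))\<^sup>2) \<le> 54\<^sup>2 * 6 * Z\<^sup>2 * real K ^ 6" .
    have "(real (card (bilinear_reps K 0)))\<^sup>2 \<le> (81 * real K ^ 3)\<^sup>2"
      by (intro power_mono card_bilinear_reps_0 K) auto
    then have 2: "(real (card (bilinear_reps K 0)))\<^sup>2 \<le> 81\<^sup>2 * real K ^ 6"
      by (simp add: power_mult_distrib flip: power_mult)
    have "(\<Sum>n\<in>I. (real (card (bilinear_reps K n)))\<^sup>2)
       = (real (card (bilinear_reps K 0)))\<^sup>2 + (\<Sum>n\<in>I - {0}. (real (card (bilinear_reps K n)))\<^sup>2)"
      by (rule sum.remove) (auto simp: I_def)
    with 1 2 show ?thesis by (simp add: I_def algebra_simps)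
  qed
  moreover have "81\<^sup>2 + 54\<^sup>2 * 6 * Z\<^sup>2 > 0" by (simp add: add_pos_nonneg)
  ultimately show ?thesis by blast
qed

text \<open>The number of coincidences is the second moment of the number of representations.\<close>

lemma bilinear_coincidences_le:
  "\<exists>C>0. \<forall>K\<ge>1. real (card {((a, b, c, e), (a', b', c', e')).
      {a, b, c, e, a', b', c', e'} \<subseteq> {-int K..int K} \<and> a * b + c * e = a' * b' + c' * e'}) \<le> C * real K ^ 6"
proof -
  obtain C where C: "C > 0" "\<And>K. K \<ge> 1 \<Longrightarrow>
      (\<Sum>n\<in>{-2 * int K ^ 2..2 * int K ^ 2}. (real (card (bilinear_reps K n)))\<^sup>2) \<le> C * real K ^ 6"
    using sum_card_bilinear_reps_sq_le by blast
  have "real (card {((a, b, c, e), (a', b', c', e')).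
      {a, b, c, e, a', b', c', e'} \<subseteq> {-int K..int K} \<and> a * b + c * e = a' * b' + c' * e'}) \<le> C * real K ^ 6"
    if K: "K \<ge> 1" for K
  proof -
    define I where "I = {-2 * int K ^ 2..2 * int K ^ 2}"
    have prod: "\<bar>a * b\<bar> \<le> int K ^ 2" if "a \<in> {-int K..int K}" "b \<in> {-int K..int K}" for a b
      using that by (auto simp: abs_mult power2_eq_square intro!: mult_mono)
    have "{((a, b, c, e), (a', b', c', e')).
      {a, b, c, e, a', b', c', e'} \<subseteq> {-int K..int K} \<and> a * b + c * e = a' * b' + c' * e'}
      \<subseteq> (\<Union>n\<in>I. bilinear_reps K n \<times> bilinear_reps K n)" (is "?L \<subseteq> ?R")
    proof safe
      fix a b c e a' b' c' e' :: int
      assume s: "{a, b, c, e, a', b', c', e'} \<subseteq> {-int K..int K}" and eq: "a * b + c * e = a' * b' + c' * e'"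
      have "a * b + c * e \<in> I" using prod[of a b] prod[of c e] s by (auto simp: I_def)
      then show "((a, b, c, e), (a', b', c', e')) \<in> ?R"
        using s eq by (intro UN_I[of "a * b + c * e"]) (simp_all add: bilinear_reps_def)
    qed
    then have "card ?L \<le> card ?R" by (intro card_mono) (auto simp: I_def)
    also have "\<dots> \<le> (\<Sum>n\<in>I. card (bilinear_reps K n \<times> bilinear_reps K n))"
      by (rule card_UN_le) (simp add: I_def)
    finally have "real (card ?L) \<le> real (\<Sum>n\<in>I. card (bilinear_reps K n \<times> bilinear_reps K n))"
      by (simp only: of_nat_le_iff)
    also have "\<dots> = (\<Sum>n\<in>I. (real (card (bilinear_reps K n)))\<^sup>2)"
      by (simp add: card_cartesian_product power2_eq_square)
    also have "\<dots> \<le> C * real K ^ 6" using C(2)[OF K] by (simp add: I_def)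
    finally show ?thesis .
  qed
  with C(1) show ?thesis by blast
qed

section \<open>A majorant for the exponential sum over distances\<close>

text \<open>The Fejer weight, of the triangular shape \<open>(2N - \<bar>u\<bar>) / N\<close>. It dominates the indicator function
  of \<open>{-N..N}\<close>, and its Fourier transform, the Fejer kernel, is nonnegative. With the
  indicator function itself the majorant would involve the absolute values of Dirichlet kernels,
  and its moments would not be counts of solutions.\<close>

definition fejer_weight :: "nat \<Rightarrow> int \<Rightarrow> real" where
  "fejer_weight N u = real (card {(a, b) \<in> {0..<2 * int N} \<times> {0..<2 * int N}. a - b = u}) / real N"

definition fejer_kernel :: "nat \<Rightarrow> nat \<Rightarrow> nat \<Rightarrow> int \<Rightarrow> real" where
  "fejer_kernel M N j v = (norm (\<Sum>a\<in>{0..<2 * int N}. echar M (- 2 * int j * v * a)))\<^sup>2 / real N"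

text \<open>Up to the weights this is \<open>\<Sum>\<^sub>v\<^sub>,\<^sub>u e(-2jvu/M)\<close>, which is of order \<open>N\<^sup>2\<close> exactly when \<open>2j/M\<close> is very
  near a fraction with bounded denominator. It stands in for the major arc decomposition.\<close>

definition exp_sum_majorant :: "nat \<Rightarrow> nat \<Rightarrow> nat \<Rightarrow> real" where
  "exp_sum_majorant M N j = (\<Sum>v\<in>{-2 * int N..2 * int N}. fejer_kernel M N j v)"

lemma fejer_kernel_nonneg: "fejer_kernel M N j v \<ge> 0"
  by (simp add: fejer_kernel_def)

lemma exp_sum_majorant_nonneg: "exp_sum_majorant M N j \<ge> 0"
  by (simp add: exp_sum_majorant_def sum_nonneg fejer_kernel_nonneg)

lemma fejer_weight_nonneg: "fejer_weight N u \<ge> 0"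
  by (simp add: fejer_weight_def)

lemma fejer_weight_ge_1:
  assumes "N > 0" "\<bar>u\<bar> \<le> int N"
  shows "fejer_weight N u \<ge> 1"
proof -
  have fin: "finite {(a, b) \<in> {0..<2 * int N} \<times> {0..<2 * int N}. a - b = u}"
    by (rule finite_subset[of _ "{0..<2 * int N} \<times> {0..<2 * int N}"]) auto
  have "(\<lambda>b. (b + max u 0, b + max (- u) 0)) ` {0..<int N} \<subseteq> {(a, b) \<in> {0..<2 * int N} \<times> {0..<2 * int N}. a - b = u}"
    using assms by (auto simp: max_def)
  moreover have "inj_on (\<lambda>b. (b + max u 0, b + max (- u) 0)) {0..<int N}"
    by (auto simp: inj_on_def)
  ultimately have "card {0..<int N} \<le> card {(a, b) \<in> {0..<2 * int N} \<times> {0..<2 * int N}. a - b = u}"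
    using card_inj_on_le fin by blast
  then show ?thesis using assms by (simp add: fejer_weight_def)
qed

lemma fejer_weight_le_2: "fejer_weight N u \<le> 2"
proof (cases "N = 0")
  case False
  have "card {(a, b) \<in> {0..<2 * int N} \<times> {0..<2 * int N}. a - b = u} \<le> card {0..<2 * int N}"
    by (rule card_inj_on_le[of snd]) (auto simp: inj_on_def)
  then show ?thesis using False by (simp add: fejer_weight_def field_simps)
qed (simp add: fejer_weight_def)

lemma fejer_kernel_eq:
  "of_real (fejer_kernel M N j v) =
     (\<Sum>u\<in>{-2 * int N..2 * int N}. of_real (fejer_weight N u) * echar M (- 2 * int j * v * u))"
proof -
  define I where "I = {0..<2 * int N}"
  define e where "e = (\<lambda>u. echar M (- 2 * int j * v * u))"
  have "complex_of_real ((norm (sum e I))\<^sup>2) = (\<Sum>(a, b)\<in>I \<times> I. e (a - b))"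
  proof -
    have "e a * cnj (e b) = e (a - b)" for a b
      unfolding e_def by (simp only: right_diff_distrib echar_diff)
    then show ?thesis by (simp only: norm_sum_sq sum.cartesian_product)
  qed
  also have "\<dots> = (\<Sum>u\<in>{-2 * int N..2 * int N}. \<Sum>(a, b)\<in>{p \<in> I \<times> I. fst p - snd p = u}. e (a - b))"
    by (rule sum.group[symmetric]) (auto simp: I_def)
  also have "\<dots> = (\<Sum>u\<in>{-2 * int N..2 * int N}. of_nat (card {p \<in> I \<times> I. fst p - snd p = u}) * e u)"
  proof (intro sum.cong refl)
    fix u
    have "(\<Sum>(a, b)\<in>{p \<in> I \<times> I. fst p - snd p = u}. e (a - b)) = (\<Sum>p\<in>{p \<in> I \<times> I. fst p - snd p = u}. e u)"
      by (intro sum.cong refl) auto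
    then show "(\<Sum>(a, b)\<in>{p \<in> I \<times> I. fst p - snd p = u}. e (a - b)) = of_nat (card {p \<in> I \<times> I. fst p - snd p = u}) * e u"
      by simp
  qed
  finally have 1: "complex_of_real ((norm (sum e I))\<^sup>2)
     = (\<Sum>u\<in>{-2 * int N..2 * int N}. of_nat (card {p \<in> I \<times> I. fst p - snd p = u}) * e u)" .
  have 2: "{p \<in> I \<times> I. fst p - snd p = u} = {(a, b) \<in> I \<times> I. a - b = u}" for u by auto
  have "of_real (fejer_kernel M N j v) = complex_of_real ((norm (sum e I))\<^sup>2) / of_nat N"
    by (simp add: fejer_kernel_def e_def I_def)
  also have "\<dots> = (\<Sum>u\<in>{-2 * int N..2 * int N}. of_real (fejer_weight N u) * e u)"
    unfolding 1 2 sum_divide_distrib by (simp add: fejer_weight_def I_def)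
  finally show ?thesis by (simp only: e_def)
qed

lemma exp_sum_majorant_le:
  "exp_sum_majorant M N j \<le> 20 * real N ^ 2"
proof (cases "N = 0")
  case True
  then show ?thesis by (simp add: exp_sum_majorant_def fejer_kernel_def)
next
  case False
  have "fejer_kernel M N j v \<le> 4 * real N" for v
  proof -
    have "norm (\<Sum>a\<in>{0..<2 * int N}. echar M (- 2 * int j * v * a)) \<le> (\<Sum>a\<in>{0..<2 * int N}. 1)"
      by (rule sum_norm_le) simp
    then have "(norm (\<Sum>a\<in>{0..<2 * int N}. echar M (- 2 * int j * v * a)))\<^sup>2 \<le> (2 * real N)\<^sup>2"
      by (intro power_mono) auto
    then show ?thesis using False by (simp add: fejer_kernel_def field_simps power2_eq_square)
  qed
  then have "exp_sum_majorant M N j \<le> (\<Sum>v\<in>{-2 * int N..2 * int N}. 4 * real N)"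
    unfolding exp_sum_majorant_def by (intro sum_mono)
  also have "\<dots> = (4 * real N + 1) * (4 * real N)" by simp
  also have "\<dots> \<le> (5 * real N) * (4 * real N)" using False by (intro mult_right_mono) auto
  finally show ?thesis by (simp add: power2_eq_square)
qed

lemma finite_int_cube [simp]: "finite (int_cube d N)"
  by (simp add: int_cube_def finite_PiE)

text \<open>Since \<open>|x-y|\<^sup>2 = |x|\<^sup>2 + |y|\<^sup>2 - 2x\<cdot>y\<close>, the double sum is a bilinear form with kernel
  \<open>e(-2j x\<cdot>y/M)\<close> and unimodular coefficients. Cauchy-Schwarz in \<open>y\<close>, followed by enlarging the range
  of \<open>y\<close> with the Fejer weight, bounds it by a sum of Fejer kernels over the differences
  \<open>x - x'\<close>, which factorises over the coordinates.\<close>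

lemma norm_distance_exp_sum_le:
  fixes d N M j :: nat
  assumes N: "N > 0" and C: "C \<subseteq> int_cube d N"
  shows "(norm (\<Sum>x\<in>C. \<Sum>y\<in>C. echar M (int j * sq_dist d x y)))\<^sup>2
       \<le> (real (card C))\<^sup>2 * exp_sum_majorant M N j ^ d"
proof -
  \<comment> \<open>\<open>a\<close> carries the unimodular factors, \<open>T y\<close> is the linear exponential sum with these coefficients.\<close>
  define a where "a = (\<lambda>x::nat \<Rightarrow> int. echar M (int j * (\<Sum>i<d. (x i)\<^sup>2)))"
  define T where "T = (\<lambda>y. \<Sum>x\<in>C. a x * echar M (\<Sum>i<d. - 2 * int j * x i * y i))"
  define Y where "Y = ({..<d} \<rightarrow>\<^sub>E {-2 * int N..2 * int N})"
  define W where "W = (\<lambda>y. \<Prod>i<d. fejer_weight N (y i))"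
  define kn where "kn = (\<lambda>x x'. \<Prod>i<d. fejer_kernel M N j (x i - x' i))"
  have finC: "finite C" using C finite_int_cube finite_subset by blast
  have finY: "finite Y" by (simp add: Y_def finite_PiE)
  have W0: "W y \<ge> 0" for y by (simp add: W_def prod_nonneg fejer_weight_nonneg)
  have a1: "norm (a x) = 1" for x by (simp add: a_def)
  have split: "echar M (int j * sq_dist d x y) = a y * (a x * echar M (\<Sum>i<d. - 2 * int j * x i * y i))" for x y
  proof -
    have "int j * sq_dist d x y = int j * (\<Sum>i<d. (y i)\<^sup>2) + (int j * (\<Sum>i<d. (x i)\<^sup>2) + (\<Sum>i<d. - 2 * int j * x i * y i))"
      by (simp add: sq_dist_def power2_diff sum.distrib sum_subtractf algebra_simps sum_distrib_left sum_negf)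
    then show ?thesis by (simp only: echar_add a_def)
  qed
  have "(\<Sum>x\<in>C. \<Sum>y\<in>C. echar M (int j * sq_dist d x y)) = (\<Sum>y\<in>C. a y * T y)"
    by (subst sum.swap) (simp only: split T_def sum_distrib_left)
  then have "norm (\<Sum>x\<in>C. \<Sum>y\<in>C. echar M (int j * sq_dist d x y)) \<le> (\<Sum>y\<in>C. norm (T y))"
    by (simp only:) (rule sum_norm_le, simp add: norm_mult a1)
  then have "(norm (\<Sum>x\<in>C. \<Sum>y\<in>C. echar M (int j * sq_dist d x y)))\<^sup>2 \<le> (\<Sum>y\<in>C. norm (T y))\<^sup>2"
    by (rule power_mono) simp
  also have "\<dots> \<le> real (card C) * (\<Sum>y\<in>C. (norm (T y))\<^sup>2)"
    using sum_squared_le_sum_of_squares[of "\<lambda>y. norm (T y)" C] by (simp add: mult.commute)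
  also have "(\<Sum>y\<in>C. (norm (T y))\<^sup>2) \<le> (\<Sum>y\<in>C. W y * (norm (T y))\<^sup>2)"
  proof (rule sum_mono)
    fix y assume "y \<in> C"
    then have "y \<in> {..<d} \<rightarrow>\<^sub>E {-int N..int N}" using C by (auto simp: int_cube_def)
    then have "y i \<in> {-int N..int N}" if "i < d" for i by (rule PiE_mem) (simp add: that)
    then have "\<bar>y i\<bar> \<le> int N" if "i < d" for i using that by fastforce
    then have "W y \<ge> 1" unfolding W_def
      by (intro prod_ge_1 fejer_weight_ge_1 N) simp
    then show "(norm (T y))\<^sup>2 \<le> W y * (norm (T y))\<^sup>2"
      using mult_right_mono[of 1 "W y" "(norm (T y))\<^sup>2"] by simp
  qed
  also have "\<dots> \<le> (\<Sum>y\<in>Y. W y * (norm (T y))\<^sup>2)"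
  proof (intro sum_mono2 finY)
    have "int_cube d N \<subseteq> Y" unfolding int_cube_def Y_def by (rule PiE_mono) auto
    then show "C \<subseteq> Y" using C by blast
  qed (simp add: W0)
  also have "\<dots> = norm (complex_of_real (\<Sum>y\<in>Y. W y * (norm (T y))\<^sup>2))"
    unfolding norm_of_real by (rule abs_of_nonneg[symmetric]) (simp add: sum_nonneg W0)
  also have "complex_of_real (\<Sum>y\<in>Y. W y * (norm (T y))\<^sup>2)
     = (\<Sum>x\<in>C. \<Sum>x'\<in>C. a x * cnj (a x') * of_real (kn x x'))"
  proof -
    have "complex_of_real (W y * (norm (T y))\<^sup>2) = (\<Sum>x\<in>C. \<Sum>x'\<in>C. a x * cnj (a x') *
        (\<Prod>i<d. of_real (fejer_weight N (y i)) * echar M (- 2 * int j * (x i - x' i) * y i)))" for y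
    proof -
      have e: "(\<Sum>i<d. - 2 * int j * x i * y i) - (\<Sum>i<d. - 2 * int j * x' i * y i)
          = (\<Sum>i<d. - 2 * int j * (x i - x' i) * y i)" for x x' :: "nat \<Rightarrow> int"
        by (simp add: sum_subtractf[symmetric] algebra_simps)
      have "complex_of_real ((norm (T y))\<^sup>2) = (\<Sum>x\<in>C. \<Sum>x'\<in>C. a x * cnj (a x') *
          echar M (\<Sum>i<d. - 2 * int j * (x i - x' i) * y i))"
        unfolding T_def norm_sum_sq e[symmetric] echar_diff
        by (intro sum.cong refl) (simp add: mult_ac)
      then show ?thesis
        by (simp add: sum_distrib_left W_def echar_sum prod.distrib of_real_prod mult_ac)
    qed
    then have "complex_of_real (\<Sum>y\<in>Y. W y * (norm (T y))\<^sup>2) = (\<Sum>y\<in>Y. \<Sum>x\<in>C. \<Sum>x'\<in>C. a x * cnj (a x') *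
        (\<Prod>i<d. of_real (fejer_weight N (y i)) * echar M (- 2 * int j * (x i - x' i) * y i)))"
      by (simp only: of_real_sum)
    also have "\<dots> = (\<Sum>x\<in>C. \<Sum>x'\<in>C. \<Sum>y\<in>Y. a x * cnj (a x') *
        (\<Prod>i<d. of_real (fejer_weight N (y i)) * echar M (- 2 * int j * (x i - x' i) * y i)))"
      by (simp only: sum.swap[where A = Y and B = C])
    also have "\<dots> = (\<Sum>x\<in>C. \<Sum>x'\<in>C. a x * cnj (a x') * of_real (kn x x'))"
    proof (intro sum.cong refl)
      fix x x' :: "nat \<Rightarrow> int"
      have "(\<Sum>y\<in>Y. \<Prod>i<d. complex_of_real (fejer_weight N (y i)) * echar M (- 2 * int j * (x i - x' i) * y i))
          = (\<Prod>i<d. \<Sum>u\<in>{-2 * int N..2 * int N}. of_real (fejer_weight N u) * echar M (- 2 * int j * (x i - x' i) * u))"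
        unfolding Y_def by (rule prod_sum_PiE[symmetric]) auto
      also have "\<dots> = of_real (kn x x')"
        by (simp only: fejer_kernel_eq[symmetric] kn_def of_real_prod)
      finally show "(\<Sum>y\<in>Y. a x * cnj (a x') *
        (\<Prod>i<d. of_real (fejer_weight N (y i)) * echar M (- 2 * int j * (x i - x' i) * y i))) = a x * cnj (a x') * of_real (kn x x')"
        by (simp only: sum_distrib_left[symmetric])
    qed
    finally show ?thesis .
  qed
  also have "norm \<dots> \<le> (\<Sum>x\<in>C. \<Sum>x'\<in>C. kn x x')"
  proof -
    have "kn x x' \<ge> 0" for x x' by (simp add: kn_def prod_nonneg fejer_kernel_nonneg)
    then show ?thesis by (intro sum_norm_le) (simp add: norm_mult a1)
  qed
  also have "\<dots> \<le> (\<Sum>x\<in>C. exp_sum_majorant M N j ^ d)"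
  proof (rule sum_mono)
    fix x assume x: "x \<in> C"
    have "(\<Sum>x'\<in>C. kn x x') \<le> (\<Sum>x'\<in>int_cube d N. kn x x')"
      by (intro sum_mono2 C) (auto simp: kn_def prod_nonneg fejer_kernel_nonneg)
    also have "\<dots> = (\<Prod>i<d. \<Sum>t\<in>{-int N..int N}. fejer_kernel M N j (x i - t))"
      unfolding int_cube_def kn_def by (rule prod_sum_PiE[symmetric]) auto
    also have "\<dots> \<le> (\<Prod>i<d. exp_sum_majorant M N j)"
    proof (intro prod_mono conjI sum_nonneg fejer_kernel_nonneg)
      fix i assume "i \<in> {..<d}"
      then have i: "i \<in> {..<d}" .
      have "x \<in> {..<d} \<rightarrow>\<^sub>E {-int N..int N}" using C x by (auto simp: int_cube_def)
      then have xi: "x i \<in> {-int N..int N}" using i by (rule PiE_mem)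
      have "(\<Sum>t\<in>{-int N..int N}. fejer_kernel M N j (x i - t)) = (\<Sum>v\<in>(\<lambda>t. x i - t) ` {-int N..int N}. fejer_kernel M N j v)"
        by (subst sum.reindex) (auto simp: inj_on_def)
      also have "\<dots> \<le> exp_sum_majorant M N j" unfolding exp_sum_majorant_def
        by (intro sum_mono2) (use xi in \<open>auto simp: fejer_kernel_nonneg\<close>)
      finally show "(\<Sum>t\<in>{-int N..int N}. fejer_kernel M N j (x i - t)) \<le> exp_sum_majorant M N j" .
    qed
    finally show "(\<Sum>x'\<in>C. kn x x') \<le> exp_sum_majorant M N j ^ d" by simp
  qed
  finally show ?thesis by (simp add: power2_eq_square mult_left_mono mult.assoc)
qed

text \<open>The square of the majorant is an exponential sum over the values \<open>-2(vu + v'u')\<close>, so Parseval turns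
  its mean square into a count of coincidences. The condition on \<open>M\<close> excludes coincidences
  modulo \<open>M\<close> that are not equalities.\<close>

lemma fourth_moment_majorant:
  "\<exists>C>0. \<forall>N M. N > 0 \<and> M > 32 * N\<^sup>2 \<longrightarrow> (\<Sum>j<M. exp_sum_majorant M N j ^ 4) \<le> C * real M * real N ^ 6"
proof -
  obtain C where C: "C > 0" "\<And>K. K \<ge> 1 \<Longrightarrow> real (card {((a, b, c, e), (a', b', c', e')).
      {a, b, c, e, a', b', c', e'} \<subseteq> {-int K..int K} \<and> a * b + c * e = a' * b' + c' * e'}) \<le> C * real K ^ 6"
    using bilinear_coincidences_le by blast
  have "(\<Sum>j<M. exp_sum_majorant M N j ^ 4) \<le> (1024 * C) * real M * real N ^ 6"
    if N: "N > 0" and M: "M > 32 * N\<^sup>2" for N M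
  proof -
    define B where "B = {-2 * int N..2 * int N}"
    define X where "X = B \<times> B \<times> B \<times> B"
    define w where "w = (\<lambda>(v::int, u, v'::int, u'). fejer_weight N u * fejer_weight N u')"
    define n where "n = (\<lambda>(v::int, u, v', u'). v * u + v' * u')"
    have finX: "finite X" by (simp add: X_def B_def)
    have M0: "M > 0" using M by simp
    have w: "0 \<le> w p" "w p \<le> 4" for p
    proof -
      obtain v u v' u' where p: "p = (v, u, v', u')" by (cases p) auto
      show "0 \<le> w p" by (simp add: w_def p fejer_weight_nonneg)
      have "fejer_weight N u * fejer_weight N u' \<le> 2 * 2"
        by (intro mult_mono fejer_weight_le_2 fejer_weight_nonneg) auto
      then show "w p \<le> 4" by (simp add: w_def p)
    qed
    have sq: "complex_of_real ((exp_sum_majorant M N j)\<^sup>2) = (\<Sum>p\<in>X. of_real (w p) * echar M (int j * (- 2 * n p)))" for j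
    proof -
      have "complex_of_real (exp_sum_majorant M N j) = (\<Sum>v\<in>B. \<Sum>u\<in>B. of_real (fejer_weight N u) * echar M (- 2 * int j * v * u))"
        by (simp only: exp_sum_majorant_def of_real_sum fejer_kernel_eq B_def)
      then have "complex_of_real ((exp_sum_majorant M N j)\<^sup>2)
        = (\<Sum>v\<in>B. \<Sum>u\<in>B. of_real (fejer_weight N u) * echar M (- 2 * int j * v * u)) *
          (\<Sum>v\<in>B. \<Sum>u\<in>B. of_real (fejer_weight N u) * echar M (- 2 * int j * v * u))"
        by (simp add: power2_eq_square)
      also have "\<dots> = (\<Sum>v\<in>B. \<Sum>u\<in>B. \<Sum>v'\<in>B. \<Sum>u'\<in>B. of_real (fejer_weight N u * fejer_weight N u') *
           echar M (int j * (- 2 * (v * u + v' * u'))))"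
      proof -
        have e: "echar M (int j * (- 2 * (v * u + v' * u'))) = echar M (- 2 * int j * v * u) * echar M (- 2 * int j * v' * u')" for v u v' u'
          by (simp add: echar_add[symmetric] algebra_simps)
        show ?thesis
          unfolding e by (simp only: sum_distrib_left sum_distrib_right) (simp add: mult_ac)
      qed
      also have "\<dots> = (\<Sum>p\<in>X. of_real (w p) * echar M (int j * (- 2 * n p)))"
        by (simp add: X_def w_def n_def sum.cartesian_product case_prod_unfold)
      finally show ?thesis .
    qed
    have "(\<Sum>j<M. exp_sum_majorant M N j ^ 4) = (\<Sum>j<M. (norm (\<Sum>p\<in>X. of_real (w p) * echar M (int j * (- 2 * n p))))\<^sup>2)"
    proof (intro sum.cong refl)
      fix j
      have "norm (complex_of_real ((exp_sum_majorant M N j)\<^sup>2)) = (exp_sum_majorant M N j)\<^sup>2"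
        unfolding norm_of_real by simp
      then show "exp_sum_majorant M N j ^ 4 = (norm (\<Sum>p\<in>X. of_real (w p) * echar M (int j * (- 2 * n p))))\<^sup>2"
        unfolding sq by (simp flip: power_mult)
    qed
    also have "\<dots> = M * (\<Sum>p\<in>X. \<Sum>q\<in>X. if int M dvd - 2 * n p - - 2 * n q then w p * w q else 0)"
      by (rule parseval_pairs[OF M0 finX])
    also have "\<dots> \<le> real M * (\<Sum>p\<in>X. \<Sum>q\<in>X. if n p = n q then 16 else 0)"
    proof (intro mult_left_mono sum_mono)
      fix p q assume p: "p \<in> X" and q: "q \<in> X"
      have n_le: "\<bar>n p\<bar> \<le> 8 * int N ^ 2" if "p \<in> X" for p
      proof -
        obtain v u v' u' where pe: "p = (v, u, v', u')" by (cases p) auto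
        have prod_le: "\<bar>v * u\<bar> \<le> (2 * int N) * (2 * int N)" if "v \<in> B" "u \<in> B" for v u
          unfolding abs_mult by (rule mult_mono) (use that in \<open>auto simp: B_def\<close>)
        have "\<bar>v * u\<bar> \<le> (2 * int N) * (2 * int N)" "\<bar>v' * u'\<bar> \<le> (2 * int N) * (2 * int N)"
          by (rule prod_le; use that in \<open>simp add: X_def pe\<close>)+
        then show ?thesis by (simp add: n_def pe power2_eq_square)
      qed
      have "w p * w q \<le> 4 * 4" by (intro mult_mono w) auto
      moreover have "n p = n q" if "int M dvd - 2 * n p - - 2 * n q"
      proof (rule ccontr)
        assume "n p \<noteq> n q"
        then have "int M \<le> \<bar>- 2 * n p - - 2 * n q\<bar>" using that by (intro zdvd_imp_le) auto
        also have "\<dots> \<le> 32 * int N ^ 2" using n_le[OF p] n_le[OF q] by linarith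
        also have "\<dots> = int (32 * N\<^sup>2)" by simp
        also have "\<dots> < int M" using M by (simp only: of_nat_less_iff)
        finally show False by simp
      qed
      ultimately show "(if int M dvd - 2 * n p - - 2 * n q then w p * w q else 0) \<le> (if n p = n q then 16 else 0)"
        by auto
    qed simp
    also have "(\<Sum>p\<in>X. \<Sum>q\<in>X. if n p = n q then 16 else 0) = 16 * real (card {pq \<in> X \<times> X. n (fst pq) = n (snd pq)})"
      unfolding sum.cartesian_product case_prod_unfold
      by (simp add: sum.If_cases finX Int_def)
    also have "{pq \<in> X \<times> X. n (fst pq) = n (snd pq)} = {((a, b, c, e), (a', b', c', e')).
      {a, b, c, e, a', b', c', e'} \<subseteq> {-int (2 * N)..int (2 * N)} \<and> a * b + c * e = a' * b' + c' * e'}"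
      by (auto simp: X_def B_def n_def)
    also have "real M * (16 * real (card \<dots>)) \<le> real M * (16 * (C * real (2 * N) ^ 6))"
      by (intro mult_left_mono C(2)) (use N in auto)
    also have "\<dots> = (1024 * C) * real M * real N ^ 6" by (simp add: power_mult_distrib)
    finally show ?thesis .
  qed
  moreover have "1024 * C > 0" using C(1) by simp
  ultimately show ?thesis by blast
qed

section \<open>Almost periods and their effect on value distributions\<close>

lemma norm_cis_diff_le: "norm (cis a - cis b) \<le> \<bar>a - b\<bar>"
proof -
  define t where "t = a - b"
  have "cis a - cis b = cis b * (cis t - 1)" by (simp add: t_def cis_mult right_diff_distrib)
  then have "norm (cis a - cis b) = norm (cis t - 1)" by (simp add: norm_mult)
  moreover have "(norm (cis t - 1))\<^sup>2 = 2 - 2 * cos t"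
  proof -
    have "(norm (cis t - 1))\<^sup>2 = (cos t - 1)\<^sup>2 + (sin t)\<^sup>2" by (simp add: cmod_power2)
    also have "\<dots> = (cos t)\<^sup>2 + (sin t)\<^sup>2 + 1 - 2 * cos t" by (simp add: power2_eq_square algebra_simps)
    finally show ?thesis using sin_cos_squared_add2[of t] by simp
  qed
  moreover have "2 - 2 * cos t \<le> t\<^sup>2"
  proof -
    have "cos t = 1 - 2 * (sin (t / 2))\<^sup>2" using cos_double_sin[of "t / 2"] by simp
    moreover have "(sin (t / 2))\<^sup>2 \<le> (t / 2)\<^sup>2"
      using abs_sin_x_le_abs_x[of "t / 2"] by (simp only: abs_le_square_iff)
    ultimately show ?thesis by (simp add: power_divide)
  qed
  ultimately have "(norm (cis a - cis b))\<^sup>2 \<le> \<bar>t\<bar>\<^sup>2" by simp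
  then show ?thesis unfolding t_def by (rule power2_le_imp_le) simp
qed

text \<open>Partition the shifts \<open>h < H\<close> according to the position of \<open>jh/M\<close> modulo 1, up to \<open>1/r\<close>, for
  all \<open>j \<in> J\<close>. The differences within one class are almost periods of all these characters; a
  largest class, shifted by its minimum, already supplies enough of them.\<close>

lemma many_common_almost_periods:
  fixes M r H :: nat
  assumes M: "M > 0" and r: "r > 0" and J: "finite J"
  shows "\<exists>G\<subseteq>{1..<H}. real H / real r ^ card J - 1 \<le> real (card G) \<and>
    (\<forall>h\<in>G. \<forall>j\<in>J. norm (echar M (int j * int h) - 1) \<le> 2 * pi / r)"
proof (cases "H = 0")
  case True
  then show ?thesis by (intro exI[of _ "{}"]) auto
next
  case False
  define cl where "cl = (\<lambda>h. restrict (\<lambda>j. (j * h) mod M * r div M) J)"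
  define B where "B = (J \<rightarrow>\<^sub>E {..<r})"
  have B: "finite B" "card B = r ^ card J" "B \<noteq> {}"
    using J r by (auto simp: B_def card_PiE PiE_eq_empty_iff intro: finite_PiE)
  have "cl \<in> {..<H} \<rightarrow> B"
  proof (intro Pi_I)
    fix h
    have "(j * h) mod M * r div M < r" for j
    proof -
      have "(j * h) mod M * r < M * r" using M r by simp
      then show ?thesis by (simp add: less_mult_imp_div_less mult.commute)
    qed
    then show "cl h \<in> B" by (auto simp: cl_def B_def)
  qed
  then obtain c where "card {..<H} \<le> card (cl -` {c} \<inter> {..<H}) * card B"
    using pigeonhole_card[of cl "{..<H}" B] B by auto
  define F where "F = cl -` {c} \<inter> {..<H}"
  have HF: "H \<le> card F * r ^ card J" using \<open>card {..<H} \<le> _\<close> B by (simp add: F_def)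
  have finF: "finite F" by (simp add: F_def)
  have "F \<noteq> {}" using HF False by (metis card.empty mult_0 le_zero_eq)
  define h0 where "h0 = Min F"
  have h0: "h0 \<in> F" "\<And>h. h \<in> F \<Longrightarrow> h0 \<le> h" using finF \<open>F \<noteq> {}\<close> by (auto simp: h0_def)
  define G where "G = (\<lambda>h. h - h0) ` (F - {h0})"
  have "inj_on (\<lambda>h. h - h0) (F - {h0})" using h0(2) by (auto simp: inj_on_def) (metis le_add_diff_inverse2)
  then have "card G = card F - 1" using h0(1) finF by (simp add: G_def card_image)
  moreover have "real H / real r ^ card J \<le> real (card F)"
  proof -
    have "real H \<le> real (card F * r ^ card J)" using HF by (simp only: of_nat_le_iff)
    then show ?thesis using r by (simp add: divide_le_eq)
  qed
  ultimately have 1: "real H / real r ^ card J - 1 \<le> real (card G)" by linarith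
  have 2: "G \<subseteq> {1..<H}"
  proof
    fix g assume "g \<in> G"
    then obtain h where "g = h - h0" "h \<in> F" "h \<noteq> h0" by (auto simp: G_def)
    then show "g \<in> {1..<H}" using h0(2)[of h] by (auto simp: F_def)
  qed
  have 3: "norm (echar M (int j * int g) - 1) \<le> 2 * pi / r" if "g \<in> G" and j: "j \<in> J" for g j
  proof -
    obtain h where h: "g = h - h0" "h \<in> F" using \<open>g \<in> G\<close> by (auto simp: G_def)
    have g: "int g = int h - int h0" using h h0(2) by (simp add: of_nat_diff)
    define x y where "x = (j * h) mod M" and "y = (j * h0) mod M"
    have "cl h = cl h0" using h h0(1) by (auto simp: F_def)
    then have "cl h j = cl h0 j" by simp
    then have q: "x * r div M = y * r div M" using j by (simp add: cl_def x_def y_def)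
    have "echar M (int j * int g) = echar M (int j * int h) * cnj (echar M (int j * int h0))"
      by (simp only: g right_diff_distrib echar_diff)
    moreover have "echar M (int j * int h0) * cnj (echar M (int j * int h0)) = 1"
      by (simp only: echar_diff[symmetric] diff_self echar_0)
    ultimately have "echar M (int j * int g) - 1 = (echar M (int j * int h) - echar M (int j * int h0)) * cnj (echar M (int j * int h0))"
      by (simp add: left_diff_distrib)
    then have "norm (echar M (int j * int g) - 1) = norm (echar M (int j * int h) - echar M (int j * int h0))"
      by (simp add: norm_mult)
    also have "\<dots> = norm (echar M (int x) - echar M (int y))"
    proof -
      have "echar M (int j * int h) = echar M (int x)" "echar M (int j * int h0) = echar M (int y)"
        by (rule echar_cong[OF M]; simp add: x_def y_def zmod_int)+
      then show ?thesis by simp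
    qed
    also have "\<dots> \<le> \<bar>2 * pi * real_of_int (int x) / real M - 2 * pi * real_of_int (int y) / real M\<bar>"
      unfolding echar_def by (rule norm_cis_diff_le)
    also have "\<dots> = 2 * pi * (\<bar>real x - real y\<bar> / real M)"
      by (simp add: abs_mult flip: diff_divide_distrib right_diff_distrib)
    also have "\<dots> \<le> 2 * pi * (1 / r)"
    proof -
      have "real (x * r) = real (x * r div M * M) + real (x * r mod M)"
           "real (y * r) = real (y * r div M * M) + real (y * r mod M)"
        by (simp_all only: of_nat_add[symmetric] div_mult_mod_eq)
      moreover have "x * r mod M < M" "y * r mod M < M" using M by simp_all
      then have "real (x * r mod M) \<le> real M" "real (y * r mod M) \<le> real M" by linarith+
      ultimately have "\<bar>real (x * r) - real (y * r)\<bar> \<le> real M" unfolding q by linarith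
      then have "\<bar>real x - real y\<bar> * real r \<le> real M"
        by (simp add: abs_mult flip: left_diff_distrib)
      then have "\<bar>real x - real y\<bar> / real M \<le> 1 / r" using M r by (simp add: field_simps)
      then show ?thesis by (intro mult_left_mono) auto
    qed
    finally show ?thesis by simp
  qed
  show ?thesis using 1 2 3 by blast
qed

lemma sum_echar_by_residue:
  assumes M: "M > 0" and X: "finite X"
  shows "(\<Sum>z\<in>{0..<int M}. of_nat (card {p\<in>X. \<phi> p mod int M = z}) * echar M (int j * z))
       = (\<Sum>p\<in>X. echar M (int j * \<phi> p))"
proof -
  have "echar M (int j * (\<phi> p mod int M)) = echar M (int j * \<phi> p)" for p
    by (rule echar_cong[OF M]) (simp add: mod_mult_right_eq)
  then show ?thesis
    using sum_by_residue[OF M X, of "\<lambda>_. 1" "\<lambda>z. echar M (int j * z)" \<phi>] by simp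
qed

lemma card_by_residue:
  assumes M: "M > 0" and X: "finite X"
  shows "real (card {p\<in>X. \<phi> p mod int M \<in> S})
       = (\<Sum>z\<in>{0..<int M}. real (card {p\<in>X. \<phi> p mod int M = z}) * (if z \<in> S then 1 else 0))"
  using sum_by_residue[OF M X, of "\<lambda>_. 1::real" "\<lambda>z. if z \<in> S then 1 else 0" \<phi>]
  by (simp add: sum.If_cases X Int_def)

text \<open>The \<open>L\<^sup>1\<close> distance between the distributions of \<open>\<phi>\<close> and \<open>\<phi> + h\<close> is at most \<open>\<surd>M\<close> times their
  \<open>L\<^sup>2\<close> distance, which Parseval computes. The loss of \<open>\<surd>M\<close> is cancelled by the normalisation of
  Parseval. Moving on from the shift \<open>th\<close> to \<open>(t+1)h\<close> costs the same, because the transforms only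
  acquire a unimodular factor.\<close>

lemma shift_changes_few_residues:
  fixes \<phi> :: "'a \<Rightarrow> int"
  assumes M: "M > 0" and X: "finite X" and \<tau>: "\<tau> \<ge> 0"
    and small: "(\<Sum>j<M. (norm (\<Sum>p\<in>X. echar M (int j * \<phi> p)))\<^sup>2 * (norm (echar M (int j * h) - 1))\<^sup>2) \<le> \<tau>\<^sup>2"
  shows "real (card {p\<in>X. (\<phi> p + int t * h) mod int M \<in> S})
       \<le> real (card {p\<in>X. \<phi> p mod int M \<in> S}) + real t * \<tau>"
proof (induction t)
  case (Suc t)
  define \<psi> where "\<psi> = (\<lambda>p. \<phi> p + int t * h)"
  define r1 where "r1 = (\<lambda>z. real (card {p\<in>X. (\<psi> p + h) mod int M = z}))"
  define r0 where "r0 = (\<lambda>z. real (card {p\<in>X. \<psi> p mod int M = z}))"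
  have FT: "norm (\<Sum>z\<in>{0..<int M}. of_real (r1 z - r0 z) * echar M (int j * z))
      = norm (\<Sum>p\<in>X. echar M (int j * \<phi> p)) * norm (echar M (int j * h) - 1)" for j
  proof -
    have "(\<Sum>z\<in>{0..<int M}. of_real (r1 z - r0 z) * echar M (int j * z))
       = (\<Sum>p\<in>X. echar M (int j * (\<psi> p + h))) - (\<Sum>p\<in>X. echar M (int j * \<psi> p))"
      unfolding sum_echar_by_residue[OF M X, symmetric]
      by (simp add: r1_def r0_def left_diff_distrib sum_subtractf)
    also have "\<dots> = echar M (int j * (int t * h)) * (\<Sum>p\<in>X. echar M (int j * \<phi> p)) * (echar M (int j * h) - 1)"
      by (simp add: \<psi>_def distrib_left echar_add sum_distrib_left sum_distrib_right sum_subtractf[symmetric] algebra_simps)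
    finally show ?thesis by (simp add: norm_mult)
  qed
  have "real M * (\<Sum>z\<in>{0..<int M}. (r1 z - r0 z)\<^sup>2) \<le> \<tau>\<^sup>2"
    unfolding parseval_residues[OF M, symmetric] FT power_mult_distrib by (rule small)
  moreover have "(\<Sum>z\<in>{0..<int M}. \<bar>r1 z - r0 z\<bar>)\<^sup>2 \<le> (\<Sum>z\<in>{0..<int M}. \<bar>r1 z - r0 z\<bar>\<^sup>2) * real (card {0..<int M})"
    by (rule sum_squared_le_sum_of_squares)
  ultimately have "(\<Sum>z\<in>{0..<int M}. \<bar>r1 z - r0 z\<bar>)\<^sup>2 \<le> \<tau>\<^sup>2" by (simp add: mult.commute)
  then have L1: "(\<Sum>z\<in>{0..<int M}. \<bar>r1 z - r0 z\<bar>) \<le> \<tau>" using \<tau> by (rule power2_le_imp_le)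
  have "real (card {p\<in>X. (\<psi> p + h) mod int M \<in> S}) - real (card {p\<in>X. \<psi> p mod int M \<in> S})
      = (\<Sum>z\<in>{0..<int M}. (r1 z - r0 z) * (if z \<in> S then 1 else 0))"
    unfolding card_by_residue[OF M X] r1_def r0_def by (simp add: sum_subtractf left_diff_distrib)
  also have "\<dots> \<le> (\<Sum>z\<in>{0..<int M}. \<bar>r1 z - r0 z\<bar>)" by (intro sum_mono) auto
  finally have "real (card {p\<in>X. (\<psi> p + h) mod int M \<in> S}) \<le> real (card {p\<in>X. \<psi> p mod int M \<in> S}) + \<tau>"
    using L1 by linarith
  moreover have "real (card {p\<in>X. \<psi> p mod int M \<in> S}) \<le> real (card {p\<in>X. \<phi> p mod int M \<in> S}) + real t * \<tau>"
    using Suc.IH by (simp only: \<psi>_def)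
  moreover have "real (Suc t) * \<tau> = real t * \<tau> + \<tau>" by (simp add: distrib_right)
  moreover have "\<phi> p + int (Suc t) * h = \<psi> p + h" for p by (simp add: \<psi>_def distrib_right)
  ultimately show ?case by simp
qed simp

text \<open>A set of pairs cannot be concentrated on few values of \<open>\<phi>\<close> if the energy of \<open>\<phi>\<close>, which is the
  second moment of its exponential sum, is small.\<close>

lemma card_sq_le_values_times_energy:
  fixes \<phi> :: "'a \<Rightarrow> int"
  assumes M: "M > 0" and X: "finite X" and Y: "Y \<subseteq> X"
  shows "real M * (real (card Y))\<^sup>2 \<le> real (card ((\<lambda>p. \<phi> p mod int M) ` Y)) *
     (\<Sum>j<M. (norm (\<Sum>p\<in>X. echar M (int j * \<phi> p)))\<^sup>2)"
proof -
  define r where "r = (\<lambda>z. real (card {p\<in>X. \<phi> p mod int M = z}))"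
  define I where "I = (\<lambda>p. \<phi> p mod int M) ` Y"
  have finY: "finite Y" using X Y finite_subset by blast
  have "Y = (\<Union>z\<in>I. {p\<in>Y. \<phi> p mod int M = z})" by (auto simp: I_def)
  then have "card Y \<le> (\<Sum>z\<in>I. card {p\<in>Y. \<phi> p mod int M = z})"
    using card_UN_le[of I "\<lambda>z. {p\<in>Y. \<phi> p mod int M = z}"] finY by (simp add: I_def)
  also have "\<dots> \<le> (\<Sum>z\<in>I. card {p\<in>X. \<phi> p mod int M = z})"
    using X Y by (intro sum_mono card_mono) auto
  finally have "real (card Y) \<le> (\<Sum>z\<in>I. r z)"
    unfolding r_def by (simp only: of_nat_le_iff flip: of_nat_sum)
  then have "(real (card Y))\<^sup>2 \<le> (\<Sum>z\<in>I. r z)\<^sup>2" by (intro power_mono) auto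
  also have "\<dots> \<le> (\<Sum>z\<in>I. (r z)\<^sup>2) * real (card I)" by (rule sum_squared_le_sum_of_squares)
  also have "\<dots> \<le> (\<Sum>z\<in>{0..<int M}. (r z)\<^sup>2) * real (card I)"
    using M by (intro mult_right_mono sum_mono2) (auto simp: I_def)
  finally have "real M * (real (card Y))\<^sup>2 \<le> real M * ((\<Sum>z\<in>{0..<int M}. (r z)\<^sup>2) * real (card I))"
    by (intro mult_left_mono) auto
  also have "\<dots> = real (card I) * (\<Sum>j<M. (norm (\<Sum>z\<in>{0..<int M}. of_real (r z) * echar M (int j * z)))\<^sup>2)"
    unfolding parseval_residues[OF M] by simp
  also have "(\<lambda>j. \<Sum>z\<in>{0..<int M}. of_real (r z) * echar M (int j * z)) = (\<lambda>j. \<Sum>p\<in>X. echar M (int j * \<phi> p))"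
    using sum_echar_by_residue[OF M X, of \<phi>] by (simp add: r_def)
  finally show ?thesis by (simp only: I_def)
qed

section \<open>Progressions of distances in dense sets\<close>

lemma sq_dist_bounds:
  assumes "x \<in> int_cube d N" "y \<in> int_cube d N"
  shows "0 \<le> sq_dist d x y" "sq_dist d x y \<le> 4 * int d * int N ^ 2"
proof -
  show "0 \<le> sq_dist d x y" by (simp add: sq_dist_def sum_nonneg)
  have "(x i - y i)\<^sup>2 \<le> 4 * int N ^ 2" if "i < d" for i
  proof -
    have "x i \<in> {-int N..int N}" "y i \<in> {-int N..int N}"
      using assms that unfolding int_cube_def by (auto simp: PiE_def Pi_def)
    then have "\<bar>x i - y i\<bar> \<le> \<bar>2 * int N\<bar>" by auto
    then have "(x i - y i)\<^sup>2 \<le> (2 * int N)\<^sup>2" by (simp only: abs_le_square_iff)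
    then show ?thesis by (simp add: power_mult_distrib)
  qed
  then have "sq_dist d x y \<le> (\<Sum>i<d. 4 * int N ^ 2)"
    unfolding sq_dist_def by (intro sum_mono) auto
  then show "sq_dist d x y \<le> 4 * int d * int N ^ 2" by simp
qed

text \<open>The trivial bound \<open>V \<le> 20N\<^sup>2\<close> raises the fourth moment to the moment of order \<open>d\<close>. As
  \<open>d \<ge> 5\<close>, one factor \<open>V\<close> is to spare, and where \<open>V < \<eta>N\<^sup>2\<close> it yields the gain \<open>\<eta>\<close>. The number of
  the remaining frequencies is bounded independently of \<open>N\<close>.\<close>

lemma majorant_moments:
  assumes d: "d \<ge> 5"
  shows "\<exists>A>0. \<forall>N>0. (\<Sum>j<64 * d * N\<^sup>2. exp_sum_majorant (64 * d * N\<^sup>2) N j ^ d) \<le> A * real N ^ (2 * d) \<and>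
    (\<forall>\<eta>>0. (\<Sum>j\<in>{j. j < 64 * d * N\<^sup>2 \<and> exp_sum_majorant (64 * d * N\<^sup>2) N j < \<eta> * real N ^ 2}.
          exp_sum_majorant (64 * d * N\<^sup>2) N j ^ d) \<le> \<eta> * A * real N ^ (2 * d) \<and>
       real (card {j. j < 64 * d * N\<^sup>2 \<and> \<eta> * real N ^ 2 \<le> exp_sum_majorant (64 * d * N\<^sup>2) N j}) \<le> A / \<eta> ^ 4)"
proof -
  obtain e where e: "d = e + 5" using d by (metis add.commute le_Suc_ex)
  obtain C where C: "C > 0" "\<And>N M. N > 0 \<Longrightarrow> M > 32 * N\<^sup>2 \<Longrightarrow> (\<Sum>j<M. exp_sum_majorant M N j ^ 4) \<le> C * real M * real N ^ 6"
    using fourth_moment_majorant by blast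
  define A0 where "A0 = 64 * real d * C"
  define A where "A = 20 ^ Suc e * A0"
  have A0: "A0 > 0" using C d by (simp add: A0_def)
  have AA: "20 ^ e * A0 \<le> A" "A0 \<le> A" "A > 0"
  proof -
    show "20 ^ e * A0 \<le> A" using A0 by (simp add: A_def)
    have "1 * A0 \<le> 20 ^ Suc e * A0" using A0 by (intro mult_right_mono one_le_power) auto
    then show "A0 \<le> A" by (simp add: A_def)
    then show "A > 0" using A0 by simp
  qed
  have "(\<Sum>j<64 * d * N\<^sup>2. exp_sum_majorant (64 * d * N\<^sup>2) N j ^ d) \<le> A * real N ^ (2 * d) \<and>
    (\<forall>\<eta>>0. (\<Sum>j\<in>{j. j < 64 * d * N\<^sup>2 \<and> exp_sum_majorant (64 * d * N\<^sup>2) N j < \<eta> * real N ^ 2}.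
          exp_sum_majorant (64 * d * N\<^sup>2) N j ^ d) \<le> \<eta> * A * real N ^ (2 * d) \<and>
       real (card {j. j < 64 * d * N\<^sup>2 \<and> \<eta> * real N ^ 2 \<le> exp_sum_majorant (64 * d * N\<^sup>2) N j}) \<le> A / \<eta> ^ 4)"
    if N: "N > 0" for N
  proof -
    define M where "M = 64 * d * N\<^sup>2"
    define V where "V = (\<lambda>j. exp_sum_majorant M N j)"
    define n where "n = real N"
    have n: "n > 0" using N by (simp add: n_def)
    have V0: "V j \<ge> 0" and V1: "V j \<le> 20 * n ^ 2" for j
      unfolding V_def n_def by (rule exp_sum_majorant_nonneg exp_sum_majorant_le)+
    have "32 * N\<^sup>2 < 64 * d * N\<^sup>2" using N d by simp
    then have "(\<Sum>j<M. V j ^ 4) \<le> C * real M * n ^ 6"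
      unfolding V_def M_def n_def by (rule C(2)[OF N])
    also have "\<dots> = A0 * n ^ 8" by (simp add: M_def A0_def n_def flip: power_add)
    finally have m4: "(\<Sum>j<M. V j ^ 4) \<le> A0 * n ^ 8" .
    have n_d: "n ^ 8 * (n\<^sup>2) ^ Suc e = n ^ (2 * d)" 
      by (simp only: power_mult[symmetric] power_add[symmetric] e) (simp add: add.commute)
    have Vd: "V j ^ d = V j ^ 4 * V j ^ Suc e" for j
    proof -
      have "d = 4 + Suc e" by (simp add: e)
      then show ?thesis by (simp only: power_add)
    qed
    have "(\<Sum>j<M. V j ^ d) \<le> (\<Sum>j<M. V j ^ 4 * (20 * n ^ 2) ^ Suc e)"
    proof (rule sum_mono)
      fix j
      show "V j ^ d \<le> V j ^ 4 * (20 * n ^ 2) ^ Suc e"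
        unfolding Vd by (intro mult_left_mono power_mono V0 V1 zero_le_power)
    qed
    also have "\<dots> = (\<Sum>j<M. V j ^ 4) * (20 * n ^ 2) ^ Suc e" by (simp only: sum_distrib_right)
    also have "\<dots> \<le> (A0 * n ^ 8) * (20 * n ^ 2) ^ Suc e" by (intro mult_right_mono m4) simp
    also have "\<dots> = A * (n ^ 8 * (n\<^sup>2) ^ Suc e)" by (simp only: A_def power_mult_distrib mult_ac)
    finally have 1: "(\<Sum>j<M. V j ^ d) \<le> A * n ^ (2 * d)" by (simp only: n_d)
    have 2: "(\<Sum>j\<in>{j. j < M \<and> V j < \<eta> * n ^ 2}. V j ^ d) \<le> \<eta> * A * n ^ (2 * d)" if \<eta>: "\<eta> > 0" for \<eta>
    proof -
      have "(\<Sum>j\<in>{j. j < M \<and> V j < \<eta> * n ^ 2}. V j ^ d) \<le> (\<Sum>j\<in>{j. j < M \<and> V j < \<eta> * n ^ 2}. V j ^ 4 * ((\<eta> * n ^ 2) * (20 * n ^ 2) ^ e))"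
      proof (rule sum_mono)
        fix j assume j: "j \<in> {j. j < M \<and> V j < \<eta> * n ^ 2}"
        have "V j ^ d = V j ^ 4 * (V j * V j ^ e)" by (simp only: Vd power_Suc)
        also have "\<dots> \<le> V j ^ 4 * ((\<eta> * n ^ 2) * (20 * n ^ 2) ^ e)"
          by (intro mult_left_mono mult_mono power_mono V0 V1 zero_le_power) (use j V0[of j] \<eta> in auto)
        finally show "V j ^ d \<le> V j ^ 4 * ((\<eta> * n ^ 2) * (20 * n ^ 2) ^ e)" .
      qed
      also have "\<dots> \<le> (\<Sum>j<M. V j ^ 4 * ((\<eta> * n ^ 2) * (20 * n ^ 2) ^ e))"
        using \<eta> n by (intro sum_mono2) (auto simp: V0)
      also have "\<dots> = (\<Sum>j<M. V j ^ 4) * ((\<eta> * n ^ 2) * (20 * n ^ 2) ^ e)" by (simp only: sum_distrib_right)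
      also have "\<dots> \<le> (A0 * n ^ 8) * ((\<eta> * n ^ 2) * (20 * n ^ 2) ^ e)"
        using \<eta> n by (intro mult_right_mono m4) simp
      also have "\<dots> = \<eta> * (20 ^ e * A0) * (n ^ 8 * (n\<^sup>2) ^ Suc e)"
        by (simp only: power_mult_distrib power_Suc mult_ac)
      also have "\<dots> \<le> \<eta> * A * (n ^ 8 * (n\<^sup>2) ^ Suc e)"
        using \<eta> AA n by (intro mult_right_mono mult_left_mono) auto
      finally show ?thesis by (simp only: n_d)
    qed
    have 3: "real (card {j. j < M \<and> \<eta> * n ^ 2 \<le> V j}) \<le> A / \<eta> ^ 4" if \<eta>: "\<eta> > 0" for \<eta>
    proof -
      have "real (card {j. j < M \<and> \<eta> * n ^ 2 \<le> V j}) * (\<eta> * n ^ 2) ^ 4 = (\<Sum>j\<in>{j. j < M \<and> \<eta> * n ^ 2 \<le> V j}. (\<eta> * n ^ 2) ^ 4)"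
        by simp
      also have "\<dots> \<le> (\<Sum>j\<in>{j. j < M \<and> \<eta> * n ^ 2 \<le> V j}. V j ^ 4)"
        using \<eta> n by (intro sum_mono power_mono) auto
      also have "\<dots> \<le> (\<Sum>j<M. V j ^ 4)" by (intro sum_mono2) (auto simp: V0)
      also have "\<dots> \<le> A * n ^ 8" by (rule order_trans[OF m4]) (intro mult_right_mono AA, simp add: n_def)
      also have "\<dots> = A / \<eta> ^ 4 * (\<eta> * n ^ 2) ^ 4"
        using \<eta> by (simp add: power_mult_distrib flip: power_mult)
      finally show ?thesis by (rule mult_right_le_imp_le) (use \<eta> n in simp)
    qed
    show ?thesis using 1 2 3 unfolding V_def M_def n_def by blast
  qed
  with AA(3) show ?thesis by blast
qed

definition progressions_in :: "nat \<Rightarrow> int set \<Rightarrow> (int \<times> int) set" where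
  "progressions_in k S = {(a, b). a \<ge> 0 \<and> b \<ge> 1 \<and> (\<forall>t::int. 0 \<le> t \<and> t \<le> int k - 1 \<longrightarrow> a + t * b \<in> S)}"

text \<open>For every almost period \<open>h\<close> of the large frequencies, the pairs \<open>(x, y)\<close> with
  \<open>|x-y|\<^sup>2 + th \<notin> S\<close> are few for \<open>t = 0\<close> by hypothesis, and hence few for each \<open>t < k\<close> because
  shifting by \<open>h\<close> hardly changes the distribution. The other pairs produce the starting points of
  progressions with difference \<open>h\<close>.\<close>

lemma dense_sets_span_progressions:
  assumes d: "d \<ge> 5" and \<alpha>: "\<alpha> > 0" and k: "k \<ge> 2"
  shows "\<exists>c>0. \<forall>\<^sub>F N in sequentially. \<forall>C S. C \<subseteq> int_cube d N \<longrightarrow> S \<subseteq> {0..4 * int d * int N ^ 2} \<longrightarrow>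
      \<alpha> * real N ^ d \<le> real (card C) \<longrightarrow>
      4 * real k * real (card {p \<in> C \<times> C. sq_dist d (fst p) (snd p) \<notin> S}) \<le> (real (card C))\<^sup>2 \<longrightarrow>
      c * real N ^ 4 \<le> real (card (progressions_in k S))"
proof -
  obtain A where A: "A > 0"
    and m1: "\<And>N. N > 0 \<Longrightarrow> (\<Sum>j<64 * d * N\<^sup>2. exp_sum_majorant (64 * d * N\<^sup>2) N j ^ d) \<le> A * real N ^ (2 * d)"
    and m2: "\<And>N \<eta>. N > 0 \<Longrightarrow> \<eta> > 0 \<Longrightarrow> (\<Sum>j\<in>{j. j < 64 * d * N\<^sup>2 \<and> exp_sum_majorant (64 * d * N\<^sup>2) N j < \<eta> * real N ^ 2}.
          exp_sum_majorant (64 * d * N\<^sup>2) N j ^ d) \<le> \<eta> * A * real N ^ (2 * d)"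
    and m3: "\<And>N \<eta>. N > 0 \<Longrightarrow> \<eta> > 0 \<Longrightarrow>
       real (card {j. j < 64 * d * N\<^sup>2 \<and> \<eta> * real N ^ 2 \<le> exp_sum_majorant (64 * d * N\<^sup>2) N j}) \<le> A / \<eta> ^ 4"
    using majorant_moments[OF d] by blast
  \<comment> \<open>With this \<open>\<beta>\<close> the shift by an almost period moves at most a proportion \<open>1/(4k\<^sup>2)\<close> of the pairs;
    \<open>\<eta>\<close> and \<open>r\<close> share it between the small and the large frequencies.\<close>
  define \<beta> where "\<beta> = \<alpha>\<^sup>2 / (16 * real k ^ 4 * A)"
  have \<beta>: "\<beta> > 0" using \<alpha> k A by (simp add: \<beta>_def)
  define \<eta> where "\<eta> = \<beta> / 8"
  have \<eta>: "\<eta> > 0" using \<beta> by (simp add: \<eta>_def)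
  obtain r where r: "2 * pi / sqrt (\<beta> / 2) < real r" using reals_Archimedean2 by blast
  have "0 < 2 * pi / sqrt (\<beta> / 2)" using \<beta> by simp
  then have r0: "r > 0" using r by (metis of_nat_0_less_iff order_less_trans)
  have r\<beta>: "(2 * pi / r)\<^sup>2 \<le> \<beta> / 2"
  proof -
    have "2 * pi / r \<le> sqrt (\<beta> / 2)" using r r0 \<beta> by (simp add: field_simps)
    then have "(2 * pi / r)\<^sup>2 \<le> (sqrt (\<beta> / 2))\<^sup>2" by (intro power_mono) auto
    then show ?thesis using \<beta> by simp
  qed
  define m0 where "m0 = nat \<lceil>A / \<eta> ^ 4\<rceil>"
  define P where "P = real r ^ m0"
  have P1: "P \<ge> 1" using r0 by (simp add: P_def)
  define c1 where "c1 = 16 * real d * \<alpha>\<^sup>2 / A"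
  define c2 where "c2 = 1 / (2 * real k * P)"
  have c12: "c1 > 0" "c2 > 0" using \<alpha> A d k P1 by (auto simp: c1_def c2_def)
  have main: "c1 * c2 * real N ^ 4 \<le> real (card (progressions_in k S))"
    if N: "N \<ge> nat \<lceil>2 * real k * (1 + P)\<rceil>" and C: "C \<subseteq> int_cube d N" and S: "S \<subseteq> {0..4 * int d * int N ^ 2}"
      and dense: "\<alpha> * real N ^ d \<le> real (card C)"
      and few: "4 * real k * real (card {p \<in> C \<times> C. sq_dist d (fst p) (snd p) \<notin> S}) \<le> (real (card C))\<^sup>2"
    for N C S
  proof -
    have Nbig: "2 * real k * (1 + P) \<le> real N" using N by linarith
    moreover have "2 * real k * (1 + P) > 0" using k P1 by simp
    ultimately have N0: "N > 0" by (metis of_nat_0_less_iff order_less_le_trans)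
    define M where "M = 64 * d * N\<^sup>2"
    have M0: "M > 0" using N0 d by (simp add: M_def)
    define V where "V = (\<lambda>j. exp_sum_majorant M N j)"
    have V0: "V j \<ge> 0" for j by (simp add: V_def exp_sum_majorant_nonneg)
    define n where "n = real (card C)"
    have n: "n > 0" using dense \<alpha> N0 unfolding n_def by (metis less_le_trans mult_pos_pos of_nat_0_less_iff zero_less_power)
    define X where "X = C \<times> C"
    define \<phi> where "\<phi> = (\<lambda>p. sq_dist d (fst p) (snd p))"
    have finC: "finite C" using C finite_int_cube finite_subset by blast
    have finX: "finite X" by (simp add: X_def finC)
    have \<phi>: "0 \<le> \<phi> p" "\<phi> p \<le> 4 * int d * int N ^ 2" if "p \<in> X" for p
    proof -
      have "fst p \<in> int_cube d N" "snd p \<in> int_cube d N" using that C by (auto simp: X_def)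
      then show "0 \<le> \<phi> p" "\<phi> p \<le> 4 * int d * int N ^ 2"
        unfolding \<phi>_def by (rule sq_dist_bounds)+
    qed
    define J where "J = {j. j < M \<and> \<eta> * real N ^ 2 \<le> V j}"
    have finJ: "finite J" by (simp add: J_def)
    have "real (card J) \<le> A / \<eta> ^ 4" unfolding J_def V_def M_def by (rule m3[OF N0 \<eta>])
    then have "card J \<le> m0" unfolding m0_def by linarith
    then have rP: "real r ^ card J \<le> P" unfolding P_def using r0 by (intro power_increasing) auto
    \<comment> \<open>The bound on \<open>h\<close> keeps \<open>|x-y|\<^sup>2 + th\<close> below \<open>M\<close> for \<open>t < k\<close>, so residues and integers agree.\<close>
    define H where "H = N\<^sup>2 div k"
    obtain G where G: "G \<subseteq> {1..<H}" "real H / real r ^ card J - 1 \<le> real (card G)"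
      and per: "\<And>h j. h \<in> G \<Longrightarrow> j \<in> J \<Longrightarrow> norm (echar M (int j * int h) - 1) \<le> 2 * pi / r"
      using many_common_almost_periods[OF M0 r0 finJ, of H] by blast
    have finG: "finite G" using G(1) finite_subset by blast
    have cardG: "c2 * real N ^ 2 \<le> real (card G)"
    proof -
      have "real (N\<^sup>2) = real (N\<^sup>2 div k * k) + real (N\<^sup>2 mod k)"
        by (simp only: of_nat_add[symmetric] div_mult_mod_eq)
      moreover have "N\<^sup>2 mod k < k" using k by simp
      ultimately have "real N ^ 2 \<le> (real H + 1) * real k" by (simp add: H_def algebra_simps)
      then have "real N ^ 2 / real k \<le> real H + 1" using k by (simp add: divide_le_eq)
      have "real N * 1 \<le> real N * real N" using N0 by (intro mult_left_mono) auto
      then have "2 * real k * (1 + P) \<le> real N ^ 2" using Nbig by (simp add: power2_eq_square)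
      then have "1 + P \<le> real N ^ 2 / (2 * real k)" using k by (simp add: field_simps)
      moreover have "real N ^ 2 / real k = real N ^ 2 / (2 * real k) + real N ^ 2 / (2 * real k)" by simp
      ultimately have "real N ^ 2 / (2 * real k) + P \<le> real H" using \<open>real N ^ 2 / real k \<le> real H + 1\<close> by linarith
      then have "(real N ^ 2 / (2 * real k) + P) / P \<le> real H / P" using P1 by (intro divide_right_mono) auto
      also have "\<dots> \<le> real H / real r ^ card J" using rP r0 P1 by (intro divide_left_mono) auto
      also have "\<dots> \<le> real (card G) + 1" using G(2) by linarith
      finally show ?thesis using P1 by (simp add: c2_def add_divide_distrib)
    qed
    have normS: "(norm (\<Sum>p\<in>X. echar M (int j * \<phi> p)))\<^sup>2 \<le> n\<^sup>2 * V j ^ d" for j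
    proof -
      have "(\<Sum>p\<in>X. echar M (int j * \<phi> p)) = (\<Sum>x\<in>C. \<Sum>y\<in>C. echar M (int j * sq_dist d x y))"
        by (simp add: X_def \<phi>_def sum.cartesian_product case_prod_unfold)
      then show ?thesis using norm_distance_exp_sum_le[OF N0 C, of M j] by (simp add: n_def V_def)
    qed
    have dense2: "\<alpha>\<^sup>2 * real N ^ (2 * d) \<le> n\<^sup>2"
    proof -
      have "(\<alpha> * real N ^ d)\<^sup>2 \<le> n\<^sup>2" using dense \<alpha> by (intro power_mono) (auto simp: n_def)
      then show ?thesis by (simp add: power_mult_distrib mult.commute flip: power_mult)
    qed
    have fiber: "c1 * real N ^ 2 \<le> real (card {a. a \<ge> 0 \<and> (\<forall>t::int. 0 \<le> t \<and> t \<le> int k - 1 \<longrightarrow> a + t * int h \<in> S)})"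
      (is "_ \<le> real (card ?T)") if h: "h \<in> G" for h
    proof -
      define \<tau> where "\<tau> = n\<^sup>2 / (4 * real k ^ 2)"
      have \<tau>0: "\<tau> \<ge> 0" by (simp add: \<tau>_def)
      have "(\<Sum>j<M. (norm (\<Sum>p\<in>X. echar M (int j * \<phi> p)))\<^sup>2 * (norm (echar M (int j * int h) - 1))\<^sup>2)
         \<le> (\<Sum>j<M. n\<^sup>2 * (\<beta> / 2 * V j ^ d + 4 * (if V j < \<eta> * real N ^ 2 then V j ^ d else 0)))"
      proof (rule sum_mono)
        fix j assume "j \<in> {..<M}"
        then have j: "j < M" by simp
        have "(norm (echar M (int j * int h) - 1))\<^sup>2 \<le> \<beta> / 2 + (if V j < \<eta> * real N ^ 2 then 4 else 0)"
        proof (cases "V j < \<eta> * real N ^ 2")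
          case True
          have "norm (echar M (int j * int h) - 1) \<le> 2"
            using norm_triangle_ineq4[of "echar M (int j * int h)" 1] by simp
          then have "(norm (echar M (int j * int h) - 1))\<^sup>2 \<le> 2\<^sup>2" by (intro power_mono) auto
          then show ?thesis using True \<beta> by simp
        next
          case False
          then have "norm (echar M (int j * int h) - 1) \<le> 2 * pi / r" using j h by (intro per) (auto simp: J_def)
          then have "(norm (echar M (int j * int h) - 1))\<^sup>2 \<le> (2 * pi / r)\<^sup>2" by (intro power_mono) auto
          then show ?thesis unfolding if_not_P[OF False] using r\<beta> by linarith
        qed
        then have "(norm (\<Sum>p\<in>X. echar M (int j * \<phi> p)))\<^sup>2 * (norm (echar M (int j * int h) - 1))\<^sup>2
          \<le> (n\<^sup>2 * V j ^ d) * (\<beta> / 2 + (if V j < \<eta> * real N ^ 2 then 4 else 0))"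
          by (intro mult_mono normS) (auto simp: V0)
        also have "\<dots> = n\<^sup>2 * (\<beta> / 2 * V j ^ d + 4 * (if V j < \<eta> * real N ^ 2 then V j ^ d else 0))"
          by (auto simp: algebra_simps)
        finally show "(norm (\<Sum>p\<in>X. echar M (int j * \<phi> p)))\<^sup>2 * (norm (echar M (int j * int h) - 1))\<^sup>2 \<le> \<dots>" .
      qed
      also have "\<dots> = n\<^sup>2 * (\<beta> / 2 * (\<Sum>j<M. V j ^ d) + 4 * (\<Sum>j<M. if V j < \<eta> * real N ^ 2 then V j ^ d else 0))"
        by (simp only: sum_distrib_left[symmetric] sum.distrib)
      also have "(\<Sum>j<M. if V j < \<eta> * real N ^ 2 then V j ^ d else 0) = (\<Sum>j\<in>{j. j < M \<and> V j < \<eta> * real N ^ 2}. V j ^ d)"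
        by (simp add: sum.If_cases Int_def)
      also have "n\<^sup>2 * (\<beta> / 2 * (\<Sum>j<M. V j ^ d) + 4 * (\<Sum>j\<in>{j. j < M \<and> V j < \<eta> * real N ^ 2}. V j ^ d))
         \<le> n\<^sup>2 * (\<beta> / 2 * (A * real N ^ (2 * d)) + 4 * (\<eta> * A * real N ^ (2 * d)))"
        using m1[OF N0] m2[OF N0 \<eta>] \<beta> by (intro mult_left_mono add_mono) (auto simp: V_def M_def)
      also have "\<dots> = n\<^sup>2 * (\<alpha>\<^sup>2 * real N ^ (2 * d)) / (16 * real k ^ 4)"
      proof -
        have "\<beta> * A = \<alpha>\<^sup>2 / (16 * real k ^ 4)" using A by (simp add: \<beta>_def)
        moreover have "\<beta> / 2 * (A * real N ^ (2 * d)) + 4 * (\<eta> * A * real N ^ (2 * d)) = (\<beta> * A) * real N ^ (2 * d)"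
          by (simp add: \<eta>_def)
        ultimately show ?thesis by simp
      qed
      also have "\<dots> \<le> n\<^sup>2 * n\<^sup>2 / (16 * real k ^ 4)"
        using dense2 by (intro divide_right_mono mult_left_mono) auto
      also have "\<dots> = \<tau>\<^sup>2" by (simp add: \<tau>_def power_divide power_mult_distrib power2_eq_square power4_eq_xxxx)
      finally have small: "(\<Sum>j<M. (norm (\<Sum>p\<in>X. echar M (int j * \<phi> p)))\<^sup>2 * (norm (echar M (int j * int h) - 1))\<^sup>2) \<le> \<tau>\<^sup>2" .
      define D where "D = (\<lambda>t. {p\<in>X. (\<phi> p + int t * int h) mod int M \<in> - S})"
      have inS: "(\<phi> p + int t * int h) mod int M = \<phi> p + int t * int h" if "p \<in> X" "t < k" for p t
      proof -
        have "h \<le> H" using h G(1) by auto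
        then have "t * h \<le> k * H" using \<open>t < k\<close> by (intro mult_mono) auto
        also have "\<dots> \<le> N\<^sup>2" by (simp add: H_def)
        finally have "int (t * h) \<le> int (N\<^sup>2)" by (simp only: of_nat_le_iff)
        then have "int t * int h \<le> int N ^ 2" by simp
        moreover have "1 * int N ^ 2 \<le> int d * int N ^ 2" using d by (intro mult_right_mono) auto
        moreover have "0 < int d * int N ^ 2" using d N0 by simp
        moreover have "int M = 64 * (int d * int N ^ 2)" by (simp add: M_def)
        moreover have "\<phi> p \<le> 4 * (int d * int N ^ 2)" using \<phi>(2)[OF \<open>p \<in> X\<close>] by (simp only: mult.assoc)
        ultimately have "\<phi> p + int t * int h < int M" by linarith
        then show ?thesis using \<phi>(1)[OF \<open>p \<in> X\<close>] by (intro mod_pos_pos_trivial) auto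
      qed
      have D0: "real (card {p\<in>X. \<phi> p mod int M \<in> - S}) \<le> n\<^sup>2 / (4 * real k)"
      proof -
        have "{p\<in>X. \<phi> p mod int M \<in> - S} = {p\<in>C \<times> C. sq_dist d (fst p) (snd p) \<notin> S}"
          using inS[of _ 0] k by (auto simp: X_def \<phi>_def)
        then show ?thesis using few k by (simp add: n_def field_simps)
      qed
      have D: "real (card (D t)) \<le> n\<^sup>2 / (2 * real k)" if "t < k" for t
      proof -
        have "real (card (D t)) \<le> real (card {p\<in>X. \<phi> p mod int M \<in> - S}) + real t * \<tau>"
          unfolding D_def by (rule shift_changes_few_residues[OF M0 finX \<tau>0 small])
        also have "\<dots> \<le> n\<^sup>2 / (4 * real k) + real k * \<tau>"
          using D0 that \<tau>0 by (intro add_mono mult_right_mono) auto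
        also have "\<dots> = n\<^sup>2 / (2 * real k)" using k by (simp add: \<tau>_def power2_eq_square)
        finally show ?thesis .
      qed
      define Y where "Y = {p\<in>X. \<forall>t<k. \<phi> p + int t * int h \<in> S}"
      have Y: "n\<^sup>2 / 2 \<le> real (card Y)"
      proof -
        have "X \<subseteq> Y \<union> (\<Union>t<k. D t)" using inS by (auto simp: Y_def D_def)
        then have "card X \<le> card (Y \<union> (\<Union>t<k. D t))"
          by (intro card_mono) (auto simp: Y_def D_def finX)
        also have "\<dots> \<le> card Y + (\<Sum>t<k. card (D t))"
          by (rule order_trans[OF card_Un_le]) (intro add_left_mono card_UN_le, simp)
        finally have "real (card X) \<le> real (card Y + (\<Sum>t<k. card (D t)))" by (simp only: of_nat_le_iff)
        also have "\<dots> = real (card Y) + (\<Sum>t<k. real (card (D t)))" by simp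
        also have "\<dots> \<le> real (card Y) + (\<Sum>t<k. n\<^sup>2 / (2 * real k))"
          by (intro add_left_mono sum_mono D) auto
        also have "\<dots> = real (card Y) + n\<^sup>2 / 2" using k by simp
        finally show ?thesis by (simp add: X_def card_cartesian_product n_def power2_eq_square)
      qed
      have "(\<Sum>j<M. (norm (\<Sum>p\<in>X. echar M (int j * \<phi> p)))\<^sup>2) \<le> n\<^sup>2 * (A * real N ^ (2 * d))"
      proof -
        have "(\<Sum>j<M. (norm (\<Sum>p\<in>X. echar M (int j * \<phi> p)))\<^sup>2) \<le> (\<Sum>j<M. n\<^sup>2 * V j ^ d)"
          by (intro sum_mono normS)
        also have "\<dots> = n\<^sup>2 * (\<Sum>j<M. V j ^ d)" by (simp only: sum_distrib_left)
        also have "\<dots> \<le> n\<^sup>2 * (A * real N ^ (2 * d))"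
          using m1[OF N0] by (intro mult_left_mono) (auto simp: V_def M_def)
        finally show ?thesis .
      qed
      then have "real (card ((\<lambda>p. \<phi> p mod int M) ` Y)) * (\<Sum>j<M. (norm (\<Sum>p\<in>X. echar M (int j * \<phi> p)))\<^sup>2)
         \<le> real (card ((\<lambda>p. \<phi> p mod int M) ` Y)) * (n\<^sup>2 * (A * real N ^ (2 * d)))"
        by (intro mult_left_mono) auto
      moreover have "real M * (real (card Y))\<^sup>2 \<le> real (card ((\<lambda>p. \<phi> p mod int M) ` Y)) * (\<Sum>j<M. (norm (\<Sum>p\<in>X. echar M (int j * \<phi> p)))\<^sup>2)"
        by (rule card_sq_le_values_times_energy[OF M0 finX]) (auto simp: Y_def)
      moreover have "real M * (n\<^sup>2 / 2)\<^sup>2 \<le> real M * (real (card Y))\<^sup>2"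
        using Y by (intro mult_left_mono power_mono) auto
      ultimately have e1: "real M * (n\<^sup>2 / 2)\<^sup>2 \<le> real (card ((\<lambda>p. \<phi> p mod int M) ` Y)) * (n\<^sup>2 * (A * real N ^ (2 * d)))"
        by linarith
      have "c1 * real N ^ 2 * (n\<^sup>2 * (A * real N ^ (2 * d))) = 16 * real d * real N ^ 2 * n\<^sup>2 * (\<alpha>\<^sup>2 * real N ^ (2 * d))"
        using A by (simp add: c1_def)
      also have "\<dots> \<le> 16 * real d * real N ^ 2 * n\<^sup>2 * n\<^sup>2"
        using dense2 by (intro mult_left_mono) auto
      also have "\<dots> = real M * (n\<^sup>2 / 2)\<^sup>2" by (simp add: M_def power_divide power2_eq_square)
      also note e1
      finally have "c1 * real N ^ 2 \<le> real (card ((\<lambda>p. \<phi> p mod int M) ` Y))"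
        using n A N0 by (simp add: mult_le_cancel_right_pos)
      also have "\<dots> \<le> real (card ?T)"
      proof -
        have "finite ?T"
        proof (rule finite_subset)
          show "?T \<subseteq> S" using k by (auto dest: spec[of _ 0])
          show "finite S" using S finite_subset by blast
        qed
        moreover have "(\<lambda>p. \<phi> p mod int M) ` Y \<subseteq> ?T"
        proof
          fix a assume "a \<in> (\<lambda>p. \<phi> p mod int M) ` Y"
          then obtain p where p: "p \<in> Y" "a = \<phi> p mod int M" by blast
          then have pX: "p \<in> X" by (simp add: Y_def)
          have a: "a = \<phi> p" using inS[OF pX, of 0] p(2) k by simp
          have "a + t * int h \<in> S" if "0 \<le> t" "t \<le> int k - 1" for t
          proof -
            have "nat t < k" "int (nat t) = t" using that by auto
            then show ?thesis using p(1) a by (auto simp: Y_def)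
          qed
          then show "a \<in> ?T" using \<phi>(1)[OF pX] a by simp
        qed
        ultimately have "card ((\<lambda>p. \<phi> p mod int M) ` Y) \<le> card ?T" by (rule card_mono)
        then show ?thesis by simp
      qed
      finally show ?thesis .
    qed
    define T where "T = (\<lambda>h. {a. a \<ge> 0 \<and> (\<forall>t::int. 0 \<le> t \<and> t \<le> int k - 1 \<longrightarrow> a + t * int h \<in> S)})"
    define R where "R = {(a, b). a \<ge> 0 \<and> b \<ge> 1 \<and> (\<forall>t::int. 0 \<le> t \<and> t \<le> int k - 1 \<longrightarrow> a + t * b \<in> S)}"
    have finS: "finite S" using S finite_subset by blast
    have "finite R"
    proof (rule inj_on_finite[of "\<lambda>(a, b). (a, a + b)"])
      show "inj_on (\<lambda>(a, b). (a, a + b)) R" by (auto simp: inj_on_def)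
      have "a \<in> S" "a + b \<in> S" if "(a, b) \<in> R" for a b
      proof -
        have t: "0 \<le> t \<Longrightarrow> t \<le> int k - 1 \<Longrightarrow> a + t * b \<in> S" for t using that by (simp add: R_def)
        show "a \<in> S" "a + b \<in> S" using t[of 0] t[of 1] k by auto
      qed
      then show "(\<lambda>(a, b). (a, a + b)) ` R \<subseteq> S \<times> S" by auto
    qed (simp add: finS)
    have finT: "finite (T h)" for h
      by (rule finite_subset[OF _ finS]) (use k in \<open>auto simp: T_def dest: spec[of _ 0]\<close>)
    have "c1 * c2 * real N ^ 4 = (c2 * real N ^ 2) * (c1 * real N ^ 2)" by (simp add: power2_eq_square power4_eq_xxxx)
    also have "\<dots> \<le> real (card G) * (c1 * real N ^ 2)"
      using cardG c12 by (intro mult_right_mono) auto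
    also have "\<dots> = (\<Sum>h\<in>G. c1 * real N ^ 2)" by simp
    also have "\<dots> \<le> (\<Sum>h\<in>G. real (card (T h)))"
      unfolding T_def by (intro sum_mono fiber)
    also have "\<dots> = real (card (SIGMA h : G. T h))"
      by (subst card_SigmaI) (auto simp: finG finT)
    also have "\<dots> \<le> real (card R)"
    proof -
      have "card (SIGMA h : G. T h) \<le> card R"
      proof (rule card_inj_on_le[of "\<lambda>(h, a). (a, int h)"])
        show "inj_on (\<lambda>(h, a). (a, int h)) (SIGMA h : G. T h)" by (auto simp: inj_on_def)
        show "(\<lambda>(h, a). (a, int h)) ` (SIGMA h : G. T h) \<subseteq> R"
          using G(1) by (auto simp: T_def R_def)
      qed (rule \<open>finite R\<close>)
      then show ?thesis by simp
    qed
    finally show ?thesis by (simp only: R_def progressions_in_def)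
  qed
  have "\<forall>\<^sub>F N in sequentially. \<forall>C S. C \<subseteq> int_cube d N \<longrightarrow> S \<subseteq> {0..4 * int d * int N ^ 2} \<longrightarrow>
      \<alpha> * real N ^ d \<le> real (card C) \<longrightarrow>
      4 * real k * real (card {p \<in> C \<times> C. sq_dist d (fst p) (snd p) \<notin> S}) \<le> (real (card C))\<^sup>2 \<longrightarrow>
      c1 * c2 * real N ^ 4 \<le> real (card (progressions_in k S))"
    using eventually_ge_at_top[of "nat \<lceil>2 * real k * (1 + P)\<rceil>"] by eventually_elim (use main in blast)
  then show ?thesis using c12 by (intro exI[of _ "c1 * c2"]) auto
qed

section \<open>Containers for sets with few progressions of distances\<close>

definition common_non_nbrs :: "'a set \<Rightarrow> ('a \<Rightarrow> 'a \<Rightarrow> bool) \<Rightarrow> 'a set \<Rightarrow> 'a set" where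
  "common_non_nbrs V R T = {v \<in> V. \<forall>t\<in>T. \<not> R t v}"

text \<open>The bound on the degrees makes the container sparse. An independent set meets it as soon as no
  further vertex of the set is worth adding to its fingerprint \<open>T\<close>.\<close>

definition container :: "'a set \<Rightarrow> ('a \<Rightarrow> 'a \<Rightarrow> bool) \<Rightarrow> real \<Rightarrow> 'a set \<Rightarrow> 'a set" where
  "container V R m T = {x \<in> common_non_nbrs V R T. real (card {y \<in> common_non_nbrs V R T. R x y}) < m}"

text \<open>Starting from the empty fingerprint, add vertices of \<open>I\<close> as long as one of them has at least \<open>m\<close>
  neighbours left. Each addition removes at least \<open>m\<close> vertices, so there are at most \<open>|V|/m\<close> of
  them, and when it stops \<open>I\<close> lies in the container. As in a dense graph \<open>m\<close> is proportional
  to \<open>|V|\<close>, fingerprints have bounded size.\<close>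

lemma independent_set_in_container:
  assumes V: "finite V" and I: "I \<subseteq> V" and indep: "\<And>x y. x \<in> I \<Longrightarrow> y \<in> I \<Longrightarrow> \<not> R x y" and m: "m > 0"
  shows "\<exists>T\<subseteq>I. real (card T) * m \<le> real (card V) \<and> I \<subseteq> container V R m T"
proof -
  define Q where "Q = (\<lambda>T. T \<subseteq> I \<and> real (card T) * m + real (card (common_non_nbrs V R T)) \<le> real (card V))"
  \<comment> \<open>A minimal number of remaining vertices replaces the iteration.\<close>
  have "Q {}" by (simp add: Q_def common_non_nbrs_def)
  then obtain T where T: "Q T" and min: "\<And>T'. Q T' \<Longrightarrow> card (common_non_nbrs V R T) \<le> card (common_non_nbrs V R T')"
    using ex_has_least_nat[of Q "{}" "\<lambda>T. card (common_non_nbrs V R T)"] by blast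
  define W where "W = common_non_nbrs V R T"
  have finW: "finite W" using V by (simp add: W_def common_non_nbrs_def)
  have "real (card {y \<in> W. R x y}) < m" if x: "x \<in> I" for x
  proof (rule ccontr)
    assume "\<not> real (card {y \<in> W. R x y}) < m"
    then have big: "m \<le> real (card {y \<in> W. R x y})" by simp
    have eq: "common_non_nbrs V R (insert x T) = W - {y \<in> W. R x y}"
      by (auto simp: W_def common_non_nbrs_def)
    have "card {y \<in> W. R x y} \<le> card W" using finW by (intro card_mono) auto
    then have c: "real (card (common_non_nbrs V R (insert x T))) = real (card W) - real (card {y \<in> W. R x y})"
      unfolding eq using finW by (subst card_Diff_subset) auto
    have "card (insert x T) \<le> card T + 1" by (simp add: card_insert_le_m1 card_insert_if le_SucI)
    then have "real (card (insert x T)) * m \<le> (real (card T) + 1) * m" using m by (intro mult_right_mono) auto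
    then have "Q (insert x T)" using T x c big by (auto simp: Q_def W_def algebra_simps)
    then have "card W \<le> card (common_non_nbrs V R (insert x T))" using min by (simp add: W_def)
    then show False using c big m by linarith
  qed
  moreover have "I \<subseteq> W" using I T indep by (auto simp: W_def common_non_nbrs_def Q_def)
  ultimately have "I \<subseteq> container V R m T" by (auto simp: container_def W_def)
  moreover have "real (card T) * m \<le> real (card V)"
  proof -
    have "real (card T) * m + real (card W) \<le> real (card V)" using T by (simp add: Q_def W_def)
    then show ?thesis using of_nat_0_le_iff[of "card W"] by linarith
  qed
  ultimately show ?thesis using T by (auto simp: Q_def)
qed

lemma container_subset: "container V R m T \<subseteq> V"
  by (auto simp: container_def common_non_nbrs_def)

lemma container_sparse:
  fixes R :: "'a \<Rightarrow> 'a \<Rightarrow> bool" and m :: real and T :: "'a set"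
  assumes V: "finite V"
  defines "C \<equiv> container V R m T"
  shows "real (card {p \<in> C \<times> C. R (fst p) (snd p)}) \<le> real (card C) * m"
proof -
  have finC: "finite C" unfolding C_def using V container_subset finite_subset by metis
  have "{p \<in> C \<times> C. R (fst p) (snd p)} = (SIGMA x : C. {y \<in> C. R x y})" by auto
  then have "card {p \<in> C \<times> C. R (fst p) (snd p)} = (\<Sum>x\<in>C. card {y \<in> C. R x y})"
    using finC by simp
  then have "real (card {p \<in> C \<times> C. R (fst p) (snd p)}) = (\<Sum>x\<in>C. real (card {y \<in> C. R x y}))" by simp
  also have "\<dots> \<le> (\<Sum>x\<in>C. m)"
  proof (rule sum_mono)
    fix x assume "x \<in> C"
    then have "real (card {y \<in> common_non_nbrs V R T. R x y}) < m" by (simp add: C_def container_def)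
    moreover have "card {y \<in> C. R x y} \<le> card {y \<in> common_non_nbrs V R T. R x y}"
      using V by (intro card_mono) (auto simp: C_def container_def common_non_nbrs_def)
    ultimately show "real (card {y \<in> C. R x y}) \<le> m" by linarith
  qed
  finally show ?thesis by simp
qed

lemma card_small_subsets_le:
  assumes "finite V" "V \<noteq> {}"
  shows "card {T. T \<subseteq> V \<and> card T \<le> s} \<le> (s + 1) * card V ^ s"
proof -
  have fin: "finite {xs. set xs \<subseteq> V \<and> length xs \<le> s}" by (rule finite_lists_length_le[OF assms(1)])
  have "{T. T \<subseteq> V \<and> card T \<le> s} \<subseteq> set ` {xs. set xs \<subseteq> V \<and> length xs \<le> s}"
  proof
    fix T assume T: "T \<in> {T. T \<subseteq> V \<and> card T \<le> s}"
    then have "finite T" using assms(1) finite_subset by auto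
    then obtain xs where "set xs = T" "distinct xs" using finite_distinct_list by blast
    then have "xs \<in> {xs. set xs \<subseteq> V \<and> length xs \<le> s}" using T distinct_card[of xs] by auto
    then show "T \<in> set ` {xs. set xs \<subseteq> V \<and> length xs \<le> s}" using \<open>set xs = T\<close> by blast
  qed
  then have "card {T. T \<subseteq> V \<and> card T \<le> s} \<le> card {xs. set xs \<subseteq> V \<and> length xs \<le> s}"
    using surj_card_le[OF fin] by blast
  also have "\<dots> = (\<Sum>i\<le>s. card V ^ i)" by (rule card_lists_length_le[OF assms(1)])
  also have "\<dots> \<le> (\<Sum>i\<le>s. card V ^ s)"
    using assms by (intro sum_mono power_increasing) (auto simp: Suc_le_eq card_gt_0_iff)
  finally show ?thesis by simp
qed

lemma card_int_cube: "card (int_cube d N) = (2 * N + 1) ^ d"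
  by (simp add: int_cube_def card_PiE nat_add_distrib nat_mult_distrib)

text \<open>For \<open>S\<close> the distance set of \<open>B\<close>, join two points if their squared distance is not in \<open>S\<close>;
  then \<open>B\<close> is independent. A
  container that is as large as \<open>\<alpha>n\<close> would be too sparse in this graph, as dense sets with so
  few pairs at distances outside \<open>S\<close> force many progressions in \<open>S\<close>. The bound on the size of
  the family is dominated by the \<open>2\<^sup>O\<^sup>(\<^sup>N\<^sup>2\<^sup>)\<close> possible distance sets; the bounded fingerprints
  contribute only a power of \<open>N\<close>.\<close>

lemma containers_for_few_progressions:
  assumes d: "d \<ge> 5" and \<alpha>: "\<alpha> > 0" and k: "k \<ge> 2"
  shows "\<exists>c>0. \<exists>K. \<forall>\<^sub>F N in sequentially. \<exists>F. finite F \<and> real (card F) \<le> exp (K * real N ^ 2) \<and>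
    (\<forall>C\<in>F. C \<subseteq> int_cube d N \<and> real (card C) < \<alpha> * real (card (int_cube d N))) \<and>
    (\<forall>B\<subseteq>int_cube d N. real (card (progressions_in k (sq_dists d B))) < c * real N ^ 4 \<longrightarrow> (\<exists>C\<in>F. B \<subseteq> C))"
proof -
  obtain c where c: "c > 0" and ev: "\<forall>\<^sub>F N in sequentially. \<forall>C S. C \<subseteq> int_cube d N \<longrightarrow> S \<subseteq> {0..4 * int d * int N ^ 2} \<longrightarrow>
      \<alpha> * real N ^ d \<le> real (card C) \<longrightarrow>
      4 * real k * real (card {p \<in> C \<times> C. sq_dist d (fst p) (snd p) \<notin> S}) \<le> (real (card C))\<^sup>2 \<longrightarrow>
      c * real N ^ 4 \<le> real (card (progressions_in k S))"
    using dense_sets_span_progressions[OF assms] by blast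
  define s where "s = nat \<lceil>4 * real k / \<alpha>\<rceil>"
  define K where "K = 4 * real d + 1 + real s + 3 * real d * real s"
  have "\<forall>\<^sub>F N in sequentially. \<exists>F. finite F \<and> real (card F) \<le> exp (K * real N ^ 2) \<and>
    (\<forall>C\<in>F. C \<subseteq> int_cube d N \<and> real (card C) < \<alpha> * real (card (int_cube d N))) \<and>
    (\<forall>B\<subseteq>int_cube d N. real (card (progressions_in k (sq_dists d B))) < c * real N ^ 4 \<longrightarrow> (\<exists>C\<in>F. B \<subseteq> C))"
    using ev eventually_gt_at_top[of 0]
  proof eventually_elim
    case (elim N)
    define V where "V = int_cube d N"
    define n where "n = real (card V)"
    have finV: "finite V" by (simp add: V_def)
    have n: "n \<ge> real N ^ d" "n > 0"
    proof -
      have "N ^ d \<le> (2 * N + 1) ^ d" by (intro power_mono) auto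
      then have "real (N ^ d) \<le> real ((2 * N + 1) ^ d)" by (simp only: of_nat_le_iff)
      then show "n \<ge> real N ^ d" by (simp add: n_def V_def card_int_cube)
      show "n > 0" by (simp add: n_def V_def card_int_cube)
    qed
    have V0: "V \<noteq> {}" using n(2) by (auto simp: n_def)
    define m where "m = \<alpha> * n / (4 * real k)"
    have m: "m > 0" using \<alpha> n k by (simp add: m_def)
    define L where "L = {0..4 * int d * int N ^ 2}"
    define R where "R = (\<lambda>S x y. sq_dist d x y \<notin> S)"
    define few where "few = {S. S \<subseteq> L \<and> real (card (progressions_in k S)) < c * real N ^ 4}"
    define small where "small = {T. T \<subseteq> V \<and> card T \<le> s}"
    define F where "F = (\<lambda>(S, T). container V (R S) m T) ` (few \<times> small)"
    have fin: "finite few" "finite small"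
      by (auto simp: few_def small_def L_def finV)
    have "finite F" unfolding F_def using fin by simp
    moreover have "real (card F) \<le> exp (K * real N ^ 2)"
    proof -
      have N1: "1 \<le> real N ^ 2" "real N \<le> real N ^ 2"
        using elim(2) one_le_power[of "real N" 2] by (auto simp: power2_eq_square)
      have ex: "real b \<le> exp (real a)" if "b \<le> a + 1" for a b
        using exp_ge_add_one_self[of "real a"] that by linarith
      have "card few \<le> card (Pow L)" by (intro card_mono) (auto simp: few_def L_def)
      also have "\<dots> = 2 ^ (4 * d * N\<^sup>2 + 1)"
      proof -
        have "card L = 4 * d * N\<^sup>2 + 1"
          by (simp add: L_def nat_add_distrib nat_mult_distrib nat_power_eq)
        then show ?thesis by (simp add: card_Pow L_def)
      qed
      finally have "real (card few) \<le> real (2 ^ (4 * d * N\<^sup>2 + 1))" by (simp only: of_nat_le_iff)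
      also have "\<dots> = real 2 ^ (4 * d * N\<^sup>2 + 1)" by simp
      also have "\<dots> \<le> exp (real 1) ^ (4 * d * N\<^sup>2 + 1)" by (intro power_mono ex) auto
      also have "\<dots> = exp (4 * real d * real N ^ 2 + 1)"
        by (simp only: exp_of_nat_mult[symmetric]) simp
      also have "\<dots> \<le> exp ((4 * real d + 1) * real N ^ 2)" using N1 by (simp add: algebra_simps)
      finally have 1: "real (card few) \<le> exp ((4 * real d + 1) * real N ^ 2)" .
      have "card small \<le> (s + 1) * card V ^ s"
        unfolding small_def by (rule card_small_subsets_le[OF finV V0])
      then have "real (card small) \<le> real ((s + 1) * card V ^ s)" by (simp only: of_nat_le_iff)
      also have "\<dots> = real (s + 1) * (real (2 * N + 1) ^ d) ^ s"
        by (simp only: of_nat_mult of_nat_power V_def card_int_cube)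
      also have "\<dots> \<le> exp (real s) * (exp (real (2 * N)) ^ d) ^ s"
        by (intro mult_mono power_mono ex) auto
      also have "\<dots> = exp (real s + real s * (real d * (2 * real N)))"
        by (simp add: exp_add flip: exp_of_nat_mult)
      also have "\<dots> \<le> exp ((real s + 3 * real d * real s) * real N ^ 2)"
      proof -
        have "real s * 1 \<le> real s * real N ^ 2" using N1 by (intro mult_left_mono) auto
        moreover have "2 * real N \<le> 3 * real N ^ 2" using N1 by linarith
        then have "real s * (real d * (2 * real N)) \<le> real s * (real d * (3 * real N ^ 2))"
          by (intro mult_left_mono) auto
        ultimately show ?thesis by (simp add: algebra_simps)
      qed
      finally have 2: "real (card small) \<le> exp ((real s + 3 * real d * real s) * real N ^ 2)" .
      have "card F \<le> card (few \<times> small)" unfolding F_def using fin by (intro card_image_le) auto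
      then have "real (card F) \<le> real (card few) * real (card small)"
        by (simp add: card_cartesian_product flip: of_nat_mult)
      also have "\<dots> \<le> exp ((4 * real d + 1) * real N ^ 2) * exp ((real s + 3 * real d * real s) * real N ^ 2)"
        by (intro mult_mono 1 2) auto
      also have "\<dots> = exp (K * real N ^ 2)" by (simp add: K_def algebra_simps flip: exp_add)
      finally show ?thesis .
    qed
    moreover have "C \<subseteq> V \<and> real (card C) < \<alpha> * n" if C: "C \<in> F" for C
    proof -
      obtain S T where S: "S \<in> few" and CT: "C = container V (R S) m T" using C by (auto simp: F_def)
      have CV: "C \<subseteq> V" using CT container_subset by metis
      have "real (card C) < \<alpha> * n"
      proof (rule ccontr)
        assume "\<not> real (card C) < \<alpha> * n"
        then have big: "\<alpha> * n \<le> real (card C)" by simp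
        have "\<alpha> * real N ^ d \<le> \<alpha> * n" using n \<alpha> by (intro mult_left_mono) auto
        then have 1: "\<alpha> * real N ^ d \<le> real (card C)" using big by linarith
        have "4 * real k * real (card {p \<in> C \<times> C. sq_dist d (fst p) (snd p) \<notin> S}) \<le> 4 * real k * (real (card C) * m)"
          using container_sparse[OF finV, of "R S" m T] by (intro mult_left_mono) (auto simp: CT R_def)
        also have "\<dots> = real (card C) * (\<alpha> * n)" using k by (simp add: m_def)
        also have "\<dots> \<le> real (card C) * real (card C)" using big by (intro mult_left_mono) auto
        finally have 2: "4 * real k * real (card {p \<in> C \<times> C. sq_dist d (fst p) (snd p) \<notin> S}) \<le> (real (card C))\<^sup>2"
          by (simp add: power2_eq_square)
        have "c * real N ^ 4 \<le> real (card (progressions_in k S))"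
          using elim(1) 1 2 CV S by (auto simp: few_def L_def V_def)
        then show False using S by (simp add: few_def)
      qed
      then show ?thesis using CV by simp
    qed
    moreover have "\<exists>C\<in>F. B \<subseteq> C" if B: "B \<subseteq> V" and fewB: "real (card (progressions_in k (sq_dists d B))) < c * real N ^ 4" for B
    proof -
      define S where "S = sq_dists d B"
      have "S \<subseteq> L"
      proof
        fix z assume "z \<in> S"
        then obtain x y where z: "z = sq_dist d x y" and "x \<in> B" "y \<in> B"
          by (auto simp: S_def sq_dists_def)
        then have "x \<in> int_cube d N" "y \<in> int_cube d N" using B by (auto simp: V_def)
        then show "z \<in> L" using sq_dist_bounds by (simp add: z L_def)
      qed
      then have S: "S \<in> few" using fewB by (simp add: few_def S_def)
      have "\<not> R S x y" if "x \<in> B" "y \<in> B" for x y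
        using that by (auto simp: R_def S_def sq_dists_def)
      then obtain T where T: "T \<subseteq> B" "real (card T) * m \<le> real (card V)" "B \<subseteq> container V (R S) m T"
        using independent_set_in_container[OF finV B, of "R S" m] m by blast
      have "real (card T) \<le> n / m" using T(2) m by (simp add: n_def le_divide_eq)
      also have "\<dots> = 4 * real k / \<alpha>" using n k \<alpha> by (simp add: m_def)
      finally have "card T \<le> s" unfolding s_def by linarith
      then have "T \<in> small" using T(1) B by (auto simp: small_def)
      then show ?thesis using S T(3) by (auto simp: F_def)
    qed
    ultimately show ?case unfolding V_def n_def by blast
  qed
  with c show ?thesis by blast
qed

section \<open>Binomial random subsets\<close>

lemma expectation_power_card_binomial_subset:
  fixes u :: real
  assumes A: "finite A" and C: "C \<subseteq> A" and p: "0 \<le> p" "p \<le> 1" and u: "u > 0"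
  shows "measure_pmf.expectation (binomial_subset_pmf A p) (\<lambda>\<Omega>. u ^ card (\<Omega> \<inter> C)) = (1 - p + p * u) ^ card C"
proof -
  define g where "g = (\<lambda>x b. if x \<in> C \<and> b then u else 1)"
  have eq: "u ^ card ({x \<in> A. f x} \<inter> C) = (\<Prod>x\<in>A. g x (f x))" for f :: "'a \<Rightarrow> bool"
  proof -
    have "(\<Prod>x\<in>A. g x (f x)) = (\<Prod>x\<in>{x \<in> A. x \<in> C \<and> f x}. u)"
      unfolding g_def using A by (intro prod.mono_neutral_cong_right) auto
    moreover have "{x \<in> A. x \<in> C \<and> f x} = {x \<in> A. f x} \<inter> C" by auto
    ultimately show ?thesis by simp
  qed
  have "measure_pmf.expectation (binomial_subset_pmf A p) (\<lambda>\<Omega>. u ^ card (\<Omega> \<inter> C))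
      = measure_pmf.expectation (Pi_pmf A False (\<lambda>_. bernoulli_pmf p)) (\<lambda>f. \<Prod>x\<in>A. g x (f x))"
    by (simp add: binomial_subset_pmf_def eq)
  also have "\<dots> = (\<Prod>x\<in>A. measure_pmf.expectation (bernoulli_pmf p) (g x))"
    using A u by (intro expectation_prod_Pi_pmf integrable_measure_pmf_finite) (auto simp: g_def)
  also have "\<dots> = (\<Prod>x\<in>A. if x \<in> C then 1 - p + p * u else 1)"
    using p by (intro prod.cong refl) (auto simp: g_def)
  also have "\<dots> = (\<Prod>x\<in>{x \<in> A. x \<in> C}. 1 - p + p * u)"
    using A by (intro prod.mono_neutral_cong_right) auto
  also have "{x \<in> A. x \<in> C} = C" using C by auto
  finally show ?thesis by simp
qed

lemma finite_set_binomial_subset_pmf: "finite A \<Longrightarrow> finite (set_pmf (binomial_subset_pmf A p))"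
  by (rule finite_subset[of _ "Pow A"]) (auto simp: binomial_subset_pmf_def)

text \<open>Markov for \<open>2\<^sup>|\<^sup>\<Omega>\<^sup>\<inter>\<^sup>C\<^sup>|\<close>, with \<open>ln 2 \<ge> 2/3\<close>.\<close>

lemma binomial_subset_upper_tail:
  assumes A: "finite A" and C: "C \<subseteq> A" and p: "0 \<le> p" "p \<le> 1" and t: "t \<ge> 0"
  shows "measure_pmf.prob (binomial_subset_pmf A p) {\<Omega>. t \<le> real (card (\<Omega> \<inter> C))} \<le> exp (p * real (card C) - 2 / 3 * t)"
proof -
  let ?M = "binomial_subset_pmf A p"
  have "{\<Omega>. t \<le> real (card (\<Omega> \<inter> C))} \<subseteq> {\<Omega>. (2::real) ^ card (\<Omega> \<inter> C) \<ge> 2 powr t}"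
    by (auto simp: powr_realpow[symmetric])
  then have "measure_pmf.prob ?M {\<Omega>. t \<le> real (card (\<Omega> \<inter> C))} \<le> measure_pmf.prob ?M {\<Omega>\<in>space ?M. (2::real) ^ card (\<Omega> \<inter> C) \<ge> 2 powr t}"
    by (intro measure_pmf.finite_measure_mono) auto
  also have "\<dots> \<le> measure_pmf.expectation ?M (\<lambda>\<Omega>. 2 ^ card (\<Omega> \<inter> C)) / 2 powr t"
    by (intro integral_Markov_inequality_measure[where A = UNIV] integrable_measure_pmf_finite finite_set_binomial_subset_pmf A) auto
  also have "\<dots> = (1 + p) ^ card C / 2 powr t"
    using expectation_power_card_binomial_subset[OF A C p, of 2] by (simp add: algebra_simps)
  also have "\<dots> \<le> exp p ^ card C / exp (2 / 3 * t)"
  proof (intro frac_le power_mono)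
    show "1 + p \<le> exp p" by (rule exp_ge_add_one_self)
    have "2 / 3 * t \<le> ln 2 * t" using ln2_ge_two_thirds t by (intro mult_right_mono) auto
    then show "exp (2 / 3 * t) \<le> 2 powr t" by (simp add: powr_def mult.commute)
  qed (use p in auto)
  also have "\<dots> = exp (p * real (card C) - 2 / 3 * t)"
    by (simp add: exp_diff mult.commute flip: exp_of_nat_mult)
  finally show ?thesis .
qed

text \<open>Markov for \<open>2\<^sup>-\<^sup>|\<^sup>\<Omega>\<^sup>|\<close>, with \<open>ln 2 \<le> 3/4\<close>.\<close>

lemma binomial_subset_lower_tail:
  assumes A: "finite A" and p: "0 \<le> p" "p \<le> 1"
  shows "measure_pmf.prob (binomial_subset_pmf A p) {\<Omega>. real (card (\<Omega> \<inter> A)) \<le> p * real (card A) / 2} \<le> exp (- (1 / 8) * (p * real (card A)))"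
proof -
  let ?M = "binomial_subset_pmf A p"
  define t where "t = p * real (card A) / 2"
  have t: "t \<ge> 0" using p by (simp add: t_def)
  have "(1 / 2) powr t \<le> (1 / 2) ^ n" if "real n \<le> t" for n
    using that by (simp add: powr_realpow[symmetric] powr_mono' )
  then have "measure_pmf.prob ?M {\<Omega>. real (card (\<Omega> \<inter> A)) \<le> t} \<le> measure_pmf.prob ?M {\<Omega>\<in>space ?M. (1/2::real) ^ card (\<Omega> \<inter> A) \<ge> (1/2) powr t}"
    by (intro measure_pmf.finite_measure_mono) auto
  also have "\<dots> \<le> measure_pmf.expectation ?M (\<lambda>\<Omega>. (1/2) ^ card (\<Omega> \<inter> A)) / (1/2) powr t"
    by (intro integral_Markov_inequality_measure[where A = UNIV] integrable_measure_pmf_finite finite_set_binomial_subset_pmf A) auto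
  also have "\<dots> = (1 - p / 2) ^ card A / (1/2) powr t"
    using expectation_power_card_binomial_subset[OF A order_refl p, of "1/2"] by (simp add: algebra_simps)
  also have "\<dots> \<le> exp (- p / 2) ^ card A / exp (- 3 / 4 * t)"
  proof (intro frac_le power_mono)
    show "1 - p / 2 \<le> exp (- p / 2)" using exp_ge_add_one_self[of "- p / 2"] by simp
    have "ln 2 * t \<le> 3 / 4 * t" using ln2_le_25_over_36 t by (intro mult_right_mono) auto
    then show "exp (- 3 / 4 * t) \<le> (1/2) powr t" by (simp add: powr_def ln_div mult.commute)
  qed (use p in auto)
  also have "\<dots> = exp (real (card A) * (- p / 2) - (- 3 / 4 * t))"
    by (simp only: exp_diff exp_of_nat_mult)
  also have "real (card A) * (- p / 2) - (- 3 / 4 * t) = - (1 / 8) * (p * real (card A))"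
    by (simp add: t_def)
  finally show ?thesis by (simp only: t_def)
qed

text \<open>A progression with positive difference is recovered from its set of terms: \<open>a\<close> is the least element,
  and \<open>b\<close> is determined because each of two possible differences divides the other.\<close>

lemma card_progressions_in_le_card_APs:
  assumes k: "k \<ge> 2" and S: "finite S"
  shows "card (progressions_in k S) \<le> card {P. nontrivial_AP k P \<and> P \<subseteq> S}"
proof (rule card_inj_on_le)
  define f where "f = (\<lambda>(a, b). {a + int t * b | t. t < k})"
  show "finite {P. nontrivial_AP k P \<and> P \<subseteq> S}"
    by (rule finite_subset[of _ "Pow S"]) (use S in auto)
  show "f ` progressions_in k S \<subseteq> {P. nontrivial_AP k P \<and> P \<subseteq> S}"
  proof
    fix P assume "P \<in> f ` progressions_in k S"
    then obtain a b where ab: "(a, b) \<in> progressions_in k S" and P: "P = {a + int t * b | t. t < k}"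
      by (auto simp: f_def)
    have "b \<noteq> 0" using ab by (auto simp: progressions_in_def)
    moreover have "a + int t * b \<in> S" if "t < k" for t
      using ab that by (auto simp: progressions_in_def)
    ultimately show "P \<in> {P. nontrivial_AP k P \<and> P \<subseteq> S}"
      by (auto simp: nontrivial_AP_def P)
  qed
  show "inj_on f (progressions_in k S)"
  proof (rule inj_onI, clarify)
    fix a b a' b' assume ab: "(a, b) \<in> progressions_in k S" "(a', b') \<in> progressions_in k S" and eq: "f (a, b) = f (a', b')"
    have b: "b \<ge> 1" "b' \<ge> 1" using ab by (auto simp: progressions_in_def)
    have mem: "\<exists>s. a + int t * b = a' + int s * b'" "\<exists>s. a' + int t * b' = a + int s * b" if "t < k" for t
    proof -
      have "a + int t * b \<in> f (a, b)" "a' + int t * b' \<in> f (a', b')" using that by (auto simp: f_def)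
      then have "a + int t * b \<in> f (a', b')" "a' + int t * b' \<in> f (a, b)" by (simp_all add: eq)
      then show "\<exists>s. a + int t * b = a' + int s * b'" "\<exists>s. a' + int t * b' = a + int s * b"
        by (auto simp: f_def)
    qed
    have "a' \<le> a" using mem(1)[of 0] k b by auto
    moreover have "a \<le> a'" using mem(2)[of 0] k b by auto
    ultimately have a: "a' = a" by simp
    obtain s where s: "b = int s * b'" using mem(1)[of 1] k a by auto
    obtain s' where s': "b' = int s' * b" using mem(2)[of 1] k a by auto
    have "b' dvd b" "b dvd b'" using s s' by (metis dvd_triv_right)+
    then have "b = b'" using b by (intro zdvd_antisym_nonneg) auto
    then show "a = a' \<and> b = b'" using a by simp
  qed
qed

theorem theorem4:
  fixes d :: nat and \<delta> :: real
  assumes "d \<ge> 5" and "0 < \<delta>" and "\<delta> < 1"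
  shows "\<exists>c :: nat \<Rightarrow> real. (\<forall>k\<ge>2. c k > 0) \<and>
    (\<forall>\<gamma>::real. 0 < \<gamma> \<and> \<gamma> < real d - 2 \<longrightarrow>
      (\<exists>C::real>0. \<forall>k\<ge>2. \<forall>\<^sub>F N in sequentially.
        measure_pmf.prob (binomial_subset_pmf (int_cube d N) (real N powr (- \<gamma>)))
          {\<Omega>. \<forall>B\<subseteq>\<Omega>. real (card B) \<ge> \<delta> * real (card \<Omega>) \<longrightarrow>
             real (card {(a, b). a \<ge> 0 \<and> b \<ge> 1 \<and>
               (\<forall>t::int. 0 \<le> t \<and> t \<le> int k - 1 \<longrightarrow> a + t * b \<in> sq_dists d B)})
               \<ge> c k * real N ^ 4 \<and>
             real (card {P. nontrivial_AP k P \<and> P \<subseteq> sq_dists d B}) \<ge> c k * real N ^ 4}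
        \<ge> 1 - exp (- C * real N powr (real d - \<gamma>))))"
proof -
  \<comment> \<open>In the failure probability only the number of containers depends on \<open>k\<close>, and it is absorbed for large \<open>N\<close>, so the
    constant \<open>\<delta>/24\<close> in the exponent serves all \<open>k\<close>.\<close>
  define covered where "covered = (\<lambda>k c K. \<forall>\<^sub>F N in sequentially. \<exists>F. finite F \<and> real (card F) \<le> exp (K * real N ^ 2) \<and>
    (\<forall>C\<in>F. C \<subseteq> int_cube d N \<and> real (card C) < (\<delta> / 4) * real (card (int_cube d N))) \<and>
    (\<forall>B\<subseteq>int_cube d N. real (card (progressions_in k (sq_dists d B))) < c * real N ^ 4 \<longrightarrow> (\<exists>C\<in>F. B \<subseteq> C)))"
  have "\<exists>c>0. \<exists>K. covered k c K" if "k \<ge> 2" for k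
    unfolding covered_def using containers_for_few_progressions[of d "\<delta> / 4" k] assms that by simp
  then have "\<forall>k. \<exists>c K. k \<ge> 2 \<longrightarrow> c > 0 \<and> covered k c K" by blast
  then obtain c K where cK: "\<forall>k. k \<ge> 2 \<longrightarrow> c k > 0 \<and> covered k (c k) (K k)" by metis
  have c: "c k > 0" if "k \<ge> 2" for k using cK that by blast
  have K: "\<forall>\<^sub>F N in sequentially. \<exists>F. finite F \<and> real (card F) \<le> exp (K k * real N ^ 2) \<and>
    (\<forall>C\<in>F. C \<subseteq> int_cube d N \<and> real (card C) < (\<delta> / 4) * real (card (int_cube d N))) \<and>
    (\<forall>B\<subseteq>int_cube d N. real (card (progressions_in k (sq_dists d B))) < c k * real N ^ 4 \<longrightarrow> (\<exists>C\<in>F. B \<subseteq> C))"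
    if "k \<ge> 2" for k using cK that unfolding covered_def by blast
  have "\<forall>\<^sub>F N in sequentially.
        measure_pmf.prob (binomial_subset_pmf (int_cube d N) (real N powr (- \<gamma>)))
          {\<Omega>. \<forall>B\<subseteq>\<Omega>. real (card B) \<ge> \<delta> * real (card \<Omega>) \<longrightarrow>
             real (card (progressions_in k (sq_dists d B))) \<ge> c k * real N ^ 4 \<and>
             real (card {P. nontrivial_AP k P \<and> P \<subseteq> sq_dists d B}) \<ge> c k * real N ^ 4}
        \<ge> 1 - exp (- (\<delta> / 24) * real N powr (real d - \<gamma>))"
    if \<gamma>: "0 < \<gamma>" "\<gamma> < real d - 2" and k: "k \<ge> 2" for \<gamma> k
  proof -
    have "\<forall>\<^sub>F N :: nat in sequentially. 1 + exp (K k * real N ^ 2) \<le> exp (\<delta> / 24 * real N powr (real d - \<gamma>))"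
    proof -
      define e where "e = real d - \<gamma> - 2"
      have e: "e > 0" using \<gamma> by (simp add: e_def)
      have "filterlim (\<lambda>N::nat. real N powr e) at_top sequentially"
        using e by real_asymp
      then have "\<forall>\<^sub>F N :: nat in sequentially. 24 / \<delta> * (\<bar>K k\<bar> + 1) \<le> real N powr e"
        by (simp add: filterlim_at_top)
      then show ?thesis using eventually_gt_at_top[of 0]
      proof eventually_elim
        case (elim N)
        have N1: "1 \<le> real N ^ 2" using elim(2) by (intro one_le_power) simp
        have "K k * real N ^ 2 \<le> \<bar>K k\<bar> * real N ^ 2" by (intro mult_right_mono) auto
        then have "exp (K k * real N ^ 2) \<le> exp (\<bar>K k\<bar> * real N ^ 2)" by simp
        moreover have "1 \<le> exp (\<bar>K k\<bar> * real N ^ 2)" by simp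
        ultimately have "1 + exp (K k * real N ^ 2) \<le> 2 * exp (\<bar>K k\<bar> * real N ^ 2)" by linarith
        also have "\<dots> \<le> exp (real N ^ 2) * exp (\<bar>K k\<bar> * real N ^ 2)"
        proof (rule mult_right_mono)
          show "2 \<le> exp (real N ^ 2)" using exp_ge_add_one_self[of "real N ^ 2"] N1 by linarith
        qed simp
        also have "\<dots> = exp ((\<bar>K k\<bar> + 1) * real N ^ 2)" by (simp add: algebra_simps flip: exp_add)
        also have "\<dots> \<le> exp (\<delta> / 24 * real N powr (real d - \<gamma>))"
        proof -
          have "\<bar>K k\<bar> + 1 \<le> \<delta> / 24 * real N powr e" using elim(1) assms(2) by (simp add: field_simps)
          then have "(\<bar>K k\<bar> + 1) * real N ^ 2 \<le> \<delta> / 24 * real N powr e * real N ^ 2"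
            by (intro mult_right_mono) auto
          also have "real N powr (real d - \<gamma>) = real N powr e * real N ^ 2"
          proof -
            have "real N powr (real d - \<gamma>) = real N powr (e + 2)" by (simp add: e_def)
            also have "\<dots> = real N powr e * real N powr 2" by (rule powr_add)
            also have "real N powr 2 = real N ^ 2" using elim(2) by (simp add: powr_numeral)
            finally show ?thesis .
          qed
          then have "\<delta> / 24 * real N powr e * real N ^ 2 = \<delta> / 24 * real N powr (real d - \<gamma>)" by simp
          finally show ?thesis by simp
        qed
        finally show ?case .
      qed
    qed
    then show ?thesis using K[OF k] eventually_gt_at_top[of 0]
    proof eventually_elim
      case (elim N)
      define V where "V = int_cube d N"
      define p where "p = real N powr (- \<gamma>)"
      define x where "x = p * real (card V)"
      define \<P> where "\<P> = binomial_subset_pmf V p"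
      have finV: "finite V" by (simp add: V_def)
      have p: "0 \<le> p" "p \<le> 1"
      proof -
        have "real N powr (- \<gamma>) \<le> real N powr 0" using elim(3) \<gamma> by (intro powr_mono) auto
        then show "p \<le> 1" using elim(3) by (simp add: p_def)
      qed (simp add: p_def)
      have x: "real N powr (real d - \<gamma>) \<le> x"
      proof -
        have "N ^ d \<le> (2 * N + 1) ^ d" by (intro power_mono) auto
        then have "real (N ^ d) \<le> real (card V)" by (simp only: of_nat_le_iff V_def card_int_cube)
        then have "p * real N ^ d \<le> x" unfolding x_def using p by (intro mult_left_mono) auto
        moreover have "real N powr (real d - \<gamma>) = p * real N ^ d"
          using elim(3) by (simp add: p_def powr_realpow[symmetric] flip: powr_add)
        ultimately show ?thesis by simp
      qed
      obtain F where F: "finite F" "real (card F) \<le> exp (K k * real N ^ 2)"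
        and small: "\<forall>C\<in>F. C \<subseteq> V \<and> real (card C) < (\<delta> / 4) * real (card V)"
        and cov: "\<forall>B\<subseteq>V. real (card (progressions_in k (sq_dists d B))) < c k * real N ^ 4 \<longrightarrow> (\<exists>C\<in>F. B \<subseteq> C)"
        using elim(2) unfolding V_def by (elim exE conjE)
      have FV: "C \<subseteq> V" and FC: "real (card C) < (\<delta> / 4) * real (card V)" if "C \<in> F" for C
        using small that by simp_all
      define good where "good = {\<Omega>. \<forall>B\<subseteq>\<Omega>. real (card B) \<ge> \<delta> * real (card \<Omega>) \<longrightarrow>
             real (card (progressions_in k (sq_dists d B))) \<ge> c k * real N ^ 4 \<and>
             real (card {P. nontrivial_AP k P \<and> P \<subseteq> sq_dists d B}) \<ge> c k * real N ^ 4}"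
      \<comment> \<open>The two ways to fail: too few points in total, or a proportion \<open>\<delta>\<close> of them in one container.\<close>
      define few where "few = {\<Omega>. real (card (\<Omega> \<inter> V)) \<le> x / 2}"
      define many where "many = (\<lambda>C :: (nat \<Rightarrow> int) set. {\<Omega>. \<delta> * x / 2 \<le> real (card (\<Omega> \<inter> C))})"
      have supp: "\<Omega> \<subseteq> V" if "\<Omega> \<in> set_pmf \<P>" for \<Omega>
        using that by (auto simp: \<P>_def binomial_subset_pmf_def)
      have cover: "\<Omega> \<in> few \<union> (\<Union>C\<in>F. many C)" if \<Omega>: "\<Omega> \<subseteq> V" and "\<Omega> \<notin> good" "\<Omega> \<notin> few" for \<Omega>
      proof -
        have big: "x / 2 < real (card \<Omega>)" using \<open>\<Omega> \<notin> few\<close> \<Omega> by (simp add: few_def Int_absorb2)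
        obtain B where B: "B \<subseteq> \<Omega>" "real (card B) \<ge> \<delta> * real (card \<Omega>)"
          and bad: "\<not> (real (card (progressions_in k (sq_dists d B))) \<ge> c k * real N ^ 4 \<and>
             real (card {P. nontrivial_AP k P \<and> P \<subseteq> sq_dists d B}) \<ge> c k * real N ^ 4)"
          using \<open>\<Omega> \<notin> good\<close> unfolding good_def by blast
        have finO: "finite \<Omega>" using \<Omega> finV finite_subset by blast
        have finB: "finite B" using B(1) finO finite_subset by blast
        have "sq_dists d B = (\<lambda>(x, y). sq_dist d x y) ` (B \<times> B)" by (auto simp: sq_dists_def)
        then have "finite (sq_dists d B)" using finB by simp
        then have "card (progressions_in k (sq_dists d B)) \<le> card {P. nontrivial_AP k P \<and> P \<subseteq> sq_dists d B}"
          by (rule card_progressions_in_le_card_APs[OF k])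
        then have "real (card (progressions_in k (sq_dists d B))) < c k * real N ^ 4"
          using bad by linarith
        then obtain C where C: "C \<in> F" "B \<subseteq> C" using cov B(1) \<Omega> by blast
        have "\<delta> * x / 2 \<le> \<delta> * real (card \<Omega>)" using big assms by simp
        also have "\<dots> \<le> real (card B)" by (rule B(2))
        also have "\<dots> \<le> real (card (\<Omega> \<inter> C))"
          using B(1) C(2) finO by (intro of_nat_mono card_mono) auto
        finally show ?thesis using C(1) by (auto simp: many_def)
      qed
      have few_le: "measure_pmf.prob \<P> few \<le> exp (- (\<delta> / 12) * x)"
      proof -
        have "measure_pmf.prob \<P> few \<le> exp (- (1 / 8) * x)"
          using binomial_subset_lower_tail[OF finV p] by (simp add: \<P>_def few_def x_def)
        also have "\<dots> \<le> exp (- (\<delta> / 12) * x)"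
        proof -
          have "\<delta> / 12 * x \<le> 1 / 8 * x" using assms p by (intro mult_right_mono) (auto simp: x_def)
          then show ?thesis by simp
        qed
        finally show ?thesis .
      qed
      have many_le: "measure_pmf.prob \<P> (many C) \<le> exp (- (\<delta> / 12) * x)" if "C \<in> F" for C
      proof -
        have t: "\<delta> * x / 2 \<ge> 0" using assms p by (simp add: x_def)
        have "measure_pmf.prob \<P> (many C) \<le> exp (p * real (card C) - 2 / 3 * (\<delta> * x / 2))"
          unfolding \<P>_def many_def by (rule binomial_subset_upper_tail[OF finV FV[OF that] p t])
        also have "\<dots> \<le> exp (- (\<delta> / 12) * x)"
        proof -
          have "p * real (card C) \<le> p * ((\<delta> / 4) * real (card V))"
            using FC[OF that] p by (intro mult_left_mono) auto
          then have "p * real (card C) \<le> \<delta> / 4 * x" by (simp add: x_def mult_ac)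
          moreover have "\<delta> / 4 * x - 2 / 3 * (\<delta> * x / 2) = - (\<delta> / 12) * x" by simp
          ultimately show ?thesis by (simp only: exp_le_cancel_iff)
        qed
        finally show ?thesis .
      qed
      have "1 - measure_pmf.prob \<P> good = measure_pmf.prob \<P> (- good)"
        by (simp add: measure_pmf.prob_compl[of good \<P>, symmetric] Compl_eq_Diff_UNIV)
      also have "\<dots> = measure_pmf.prob \<P> (- good \<inter> set_pmf \<P>)" by (simp add: measure_Int_set_pmf)
      also have "\<dots> \<le> measure_pmf.prob \<P> (few \<union> (\<Union>C\<in>F. many C))"
        using cover supp by (intro measure_pmf.finite_measure_mono) auto
      also have "\<dots> \<le> measure_pmf.prob \<P> few + measure_pmf.prob \<P> (\<Union>C\<in>F. many C)"
        by (rule measure_Un_le) auto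
      also have "\<dots> \<le> measure_pmf.prob \<P> few + (\<Sum>C\<in>F. measure_pmf.prob \<P> (many C))"
        by (intro add_left_mono measure_pmf.finite_measure_subadditive_finite F) auto
      also have "\<dots> \<le> exp (- (\<delta> / 12) * x) + (\<Sum>C\<in>F. exp (- (\<delta> / 12) * x))"
        by (intro add_mono sum_mono few_le many_le)
      also have "\<dots> = (1 + real (card F)) * exp (- (\<delta> / 12) * x)" by (simp add: distrib_right)
      also have "\<dots> \<le> exp (\<delta> / 24 * real N powr (real d - \<gamma>)) * exp (- (\<delta> / 12) * real N powr (real d - \<gamma>))"
      proof (intro mult_mono)
        show "1 + real (card F) \<le> exp (\<delta> / 24 * real N powr (real d - \<gamma>))" using elim(1) F(2) by linarith
        have "\<delta> / 12 * real N powr (real d - \<gamma>) \<le> \<delta> / 12 * x" using x assms by (intro mult_left_mono) auto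
        then show "exp (- (\<delta> / 12) * x) \<le> exp (- (\<delta> / 12) * real N powr (real d - \<gamma>))" by simp
      qed auto
      also have "\<dots> = exp (- (\<delta> / 24) * real N powr (real d - \<gamma>))" by (simp flip: exp_add)
      finally show ?case unfolding good_def \<P>_def V_def p_def by linarith
    qed
  qed
  then show ?thesis
    using c assms(2) unfolding progressions_in_def
    by (intro exI[of _ c] conjI allI impI exI[of _ "\<delta> / 24"]) auto
qed

end
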